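(* Let $d\ge 2$ and $\alpha\ge 1$ be integers and $G$ a finite graph. Then $K_{2+\alpha}\star G$ is $d$-ball packable if and only if $G$ is isomorphic to the tangency graph of a $(d-1,\alpha)$-kissing configuration.
   Context: A $(n,\alpha)$-kissing configuration is a packing of unit $n$-balls (in $\mathbb R^n$) each of which is tangent to each of $\alpha$ fixed pairwise tangent unit $n$-balls (the $\alpha$ fixed balls are not part of the configuration); its tangency graph has the balls of the configuration as vertices and tangent pairs as edges. $K_n$ is the complete graph; $G\star H$ is the join of graphs. A $d$-ball in $\hat{\mathbb R}^d$ is a closed ball, closed exterior of an open ball with $\infty$, or a closed half-space with $\infty$; a $d$-ball packing is a collection of $d$-balls with disjoint interiors; its tangency graph joins balls meeting in exactly one point; a graph is $d$-ball packable if isomorphic to the tangency graph of some $d$-ball packing. *)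

theory Defs
  imports Complex_Main
begin

definition euc :: "nat \<Rightarrow> (nat \<Rightarrow> real) set" where
  "euc n = {x. \<forall>i\<ge>n. x i = 0}"

definition edist :: "nat \<Rightarrow> (nat \<Rightarrow> real) \<Rightarrow> (nat \<Rightarrow> real) \<Rightarrow> real" where
  "edist n x y = sqrt (\<Sum>i<n. (x i - y i)\<^sup>2)"

definition einner :: "nat \<Rightarrow> (nat \<Rightarrow> real) \<Rightarrow> (nat \<Rightarrow> real) \<Rightarrow> real" where
  "einner n x y = (\<Sum>i<n. x i * y i)"

definition euc_interior :: "nat \<Rightarrow> (nat \<Rightarrow> real) set \<Rightarrow> (nat \<Rightarrow> real) set" where
  "euc_interior n S = {x \<in> S \<inter> euc n. \<exists>e>0. \<forall>y\<in>euc n. edist n x y < e \<longrightarrow> y \<in> S}"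

section \<open>The one-point compactification of R^d (None = infinity)\<close>

definition ext_space :: "nat \<Rightarrow> (nat \<Rightarrow> real) option set" where
  "ext_space d = insert None (Some ` euc d)"

definition ext_open :: "nat \<Rightarrow> (nat \<Rightarrow> real) option set \<Rightarrow> bool" where
  "ext_open d U \<longleftrightarrow> U \<subseteq> ext_space d
     \<and> (\<forall>x. Some x \<in> U \<longrightarrow> (\<exists>e>0. \<forall>y\<in>euc d. edist d x y < e \<longrightarrow> Some y \<in> U))
     \<and> (None \<in> U \<longrightarrow> (\<exists>R. \<forall>y\<in>euc d. edist d y (\<lambda>_. 0) > R \<longrightarrow> Some y \<in> U))"

definition ext_interior :: "nat \<Rightarrow> (nat \<Rightarrow> real) option set \<Rightarrow> (nat \<Rightarrow> real) option set" where
  "ext_interior d B = \<Union>{U. ext_open d U \<and> U \<subseteq> B}"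

definition d_ball :: "nat \<Rightarrow> (nat \<Rightarrow> real) option set \<Rightarrow> bool" where
  "d_ball d B \<longleftrightarrow>
     (\<exists>c\<in>euc d. \<exists>r>0. B = Some ` {x \<in> euc d. edist d x c \<le> r})
   \<or> (\<exists>c\<in>euc d. \<exists>r>0. B = insert None (Some ` {x \<in> euc d. edist d x c \<ge> r}))
   \<or> (\<exists>a\<in>euc d. \<exists>b. a \<noteq> (\<lambda>_. 0) \<and> B = insert None (Some ` {x \<in> euc d. einner d a x \<le> b}))"

definition d_ball_packing :: "nat \<Rightarrow> (nat \<Rightarrow> real) option set set \<Rightarrow> bool" where
  "d_ball_packing d P \<longleftrightarrow> (\<forall>B\<in>P. d_ball d B)
     \<and> (\<forall>B\<in>P. \<forall>C\<in>P. B \<noteq> C \<longrightarrow> ext_interior d B \<inter> ext_interior d C = {})"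

type_synonym 'v graph = "'v set \<times> ('v \<Rightarrow> 'v \<Rightarrow> bool)"

definition finite_graph :: "'v graph \<Rightarrow> bool" where
  "finite_graph G \<longleftrightarrow> finite (fst G)
     \<and> (\<forall>u v. snd G u v \<longrightarrow> u \<in> fst G \<and> v \<in> fst G)
     \<and> (\<forall>u v. snd G u v \<longrightarrow> snd G v u)
     \<and> (\<forall>u. \<not> snd G u u)"

definition graph_iso :: "'v graph \<Rightarrow> 'w graph \<Rightarrow> bool" where
  "graph_iso G H \<longleftrightarrow> (\<exists>f. bij_betw f (fst G) (fst H)
     \<and> (\<forall>u\<in>fst G. \<forall>v\<in>fst G. snd G u v \<longleftrightarrow> snd H (f u) (f v)))"

definition complete_graph :: "nat \<Rightarrow> nat graph" where
  "complete_graph m = ({..<m}, \<lambda>i j. i < m \<and> j < m \<and> i \<noteq> j)"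

definition graph_join :: "'v graph \<Rightarrow> 'w graph \<Rightarrow> ('v + 'w) graph" where
  "graph_join G H = (Inl ` fst G \<union> Inr ` fst H,
     \<lambda>x y. case (x, y) of
        (Inl u, Inl v) \<Rightarrow> snd G u v
      | (Inr u, Inr v) \<Rightarrow> snd H u v
      | (Inl u, Inr v) \<Rightarrow> u \<in> fst G \<and> v \<in> fst H
      | (Inr u, Inl v) \<Rightarrow> u \<in> fst H \<and> v \<in> fst G)"

definition tangent :: "'p set \<Rightarrow> 'p set \<Rightarrow> bool" where
  "tangent B C \<longleftrightarrow> (\<exists>!p. p \<in> B \<inter> C)"

definition tangency_graph :: "'p set set \<Rightarrow> 'p set graph" where
  "tangency_graph P = (P, \<lambda>B C. B \<in> P \<and> C \<in> P \<and> B \<noteq> C \<and> tangent B C)"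

definition ball_packable :: "nat \<Rightarrow> 'v graph \<Rightarrow> bool" where
  "ball_packable d G \<longleftrightarrow> (\<exists>P. d_ball_packing d P \<and> graph_iso G (tangency_graph P))"

definition unit_ball :: "nat \<Rightarrow> (nat \<Rightarrow> real) \<Rightarrow> (nat \<Rightarrow> real) set" where
  "unit_ball n c = {x \<in> euc n. edist n x c \<le> 1}"

definition is_unit_ball :: "nat \<Rightarrow> (nat \<Rightarrow> real) set \<Rightarrow> bool" where
  "is_unit_ball n B \<longleftrightarrow> (\<exists>c\<in>euc n. B = unit_ball n c)"

definition kissing_config :: "nat \<Rightarrow> nat \<Rightarrow> (nat \<Rightarrow> real) set set \<Rightarrow> bool" where
  "kissing_config n \<alpha> S \<longleftrightarrow> (\<exists>F.
       finite F \<and> card F = \<alpha> \<and> (\<forall>C\<in>F. is_unit_ball n C)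
     \<and> (\<forall>C\<in>F. \<forall>C'\<in>F. C \<noteq> C' \<longrightarrow> tangent C C')
     \<and> S \<inter> F = {}
     \<and> (\<forall>B\<in>S. is_unit_ball n B)
     \<and> (\<forall>B\<in>S. \<forall>B'\<in>S. B \<noteq> B' \<longrightarrow> euc_interior n B \<inter> euc_interior n B' = {})
     \<and> (\<forall>B\<in>S. \<forall>C\<in>F. tangent B C))"

end

theory Submission
  imports Defs
begin

text \<open>
  Write every generalised ball as a sublevel set \<open>A|x|\<^sup>2 - 2 b\<bullet>x + c \<le> 0\<close>, with \<open>\<infinity>\<close> belonging to it
  iff \<open>A \<le> 0\<close>. In a packing of \<open>K\<^sub>2\<^sub>+\<^sub>\<alpha> \<star> G\<close> invert at the tangency point of two balls of the
  complete part. These two become half-spaces with parallel boundaries, and every other ball, being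
  tangent to both, becomes a ball of a fixed radius whose centre lies on the middle hyperplane.
  After rescaling, cutting with that hyperplane leaves unit balls of dimension \<open>d - 1\<close> with the
  same tangencies; conversely unit balls of dimension \<open>d - 1\<close> are fattened and placed between two
  walls. Both sides of the equivalence thus amount to centres in dimension \<open>d - 1\<close> at mutual
  distance at least 2, with equality exactly for adjacent vertices.
\<close>

section \<open>The inner product on coordinate functions\<close>

text \<open>Topological interiors are never computed. From a packing only the strict sublevel sets
  are used: they lie inside the interiors, and inversion maps them exactly onto sets of the same
  kind. In the other direction it suffices that two distinct balls share at most one point. The
  invariant carried through the inversion is positivity of \<open>einner d b b - A * c\<close>,
  which says that the radius or the normal vector is nonzero. The obstacle is to show that only the
  two chosen balls become half-spaces: an exterior overlaps a half-space far out, and a third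
  half-space would need a normal antiparallel to two vectors that are already antiparallel to each
  other. The fixed balls and the vertices of \<open>G\<close> are treated alike until the very end,
  where they differ only as \<open>Inl\<close> and \<open>Inr\<close> vertices.\<close>

lemma einner_add_left: "einner d (\<lambda>i. f i + g i) z = einner d f z + einner d g z"
  by (simp add: einner_def distrib_right sum.distrib)

lemma einner_diff_left: "einner d (\<lambda>i. f i - g i) z = einner d f z - einner d g z"
  by (simp add: einner_def left_diff_distrib sum_subtractf)

lemma einner_scale_left: "einner d (\<lambda>i. k * f i) z = k * einner d f z"
  by (simp add: einner_def sum_distrib_left mult.assoc)

lemma einner_commute: "einner d x y = einner d y x"
  by (simp add: einner_def mult.commute)

lemma einner_add_right: "einner d z (\<lambda>i. f i + g i) = einner d z f + einner d z g"
  by (metis einner_add_left einner_commute)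

lemma einner_diff_right: "einner d z (\<lambda>i. f i - g i) = einner d z f - einner d z g"
  by (metis einner_diff_left einner_commute)

lemma einner_scale_right: "einner d z (\<lambda>i. k * f i) = k * einner d z f"
  by (metis einner_scale_left einner_commute)

lemmas einner_linear = einner_add_left einner_diff_left einner_scale_left
  einner_add_right einner_diff_right einner_scale_right

lemma einner_zero [simp]: "einner d (\<lambda>i. 0) z = 0" "einner d z (\<lambda>i. 0) = 0"
  by (simp_all add: einner_def)

lemma einner_self_nonneg: "0 \<le> einner d x x"
  by (simp add: einner_def sum_nonneg)

lemma einner_self_eq_0: "einner d x x = 0 \<Longrightarrow> i < d \<Longrightarrow> x i = 0"
  by (simp add: einner_def sum_nonneg_eq_0_iff)

lemma einner_eq_0_left: "einner d x x = 0 \<Longrightarrow> einner d x z = 0"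
  by (simp add: einner_def sum_nonneg_eq_0_iff)

lemma edist_einner: "edist d x y = sqrt (einner d (\<lambda>i. x i - y i) (\<lambda>i. x i - y i))"
  by (simp add: edist_def einner_def power2_eq_square)

lemma edist_sq: "(edist d x y)\<^sup>2 = einner d (\<lambda>i. x i - y i) (\<lambda>i. x i - y i)"
  by (simp add: edist_einner einner_self_nonneg)

lemma edist_nonneg [simp]: "0 \<le> edist d x y"
  by (simp add: edist_einner einner_self_nonneg)

lemma edist_commute: "edist d x y = edist d y x"
  by (simp add: edist_def power2_commute)

lemma edist_le_iff: "0 \<le> r \<Longrightarrow> edist d x y \<le> r \<longleftrightarrow> (edist d x y)\<^sup>2 \<le> r\<^sup>2"
  by (metis abs_le_square_iff abs_of_nonneg edist_nonneg)

lemma edist_less_iff: "0 \<le> r \<Longrightarrow> edist d x y < r \<longleftrightarrow> (edist d x y)\<^sup>2 < r\<^sup>2"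
  by (auto intro: power_strict_mono power2_less_imp_less)

lemma edist_expand:
  "(edist d x y)\<^sup>2 = einner d x x - 2 * einner d y x + einner d y y"
  by (simp add: edist_sq einner_linear einner_commute[of d y x])

lemma einner_Cauchy_Schwarz_sq: "(einner d x y)\<^sup>2 \<le> einner d x x * einner d y y"
proof (cases "einner d y y = 0")
  case True
  then show ?thesis
    by (simp add: einner_eq_0_left einner_commute[of d x y])
next
  case False
  then have pos: "0 < einner d y y"
    using einner_self_nonneg[of d y] by linarith
  \<comment> \<open>\<open>?w\<close> is \<open>einner d y y\<close> times the component of
    \<open>x\<close> orthogonal to \<open>y\<close>.\<close>
  let ?w = "\<lambda>i. einner d y y * x i - einner d x y * y i"
  have "einner d ?w ?w = einner d y y * (einner d x x * einner d y y - (einner d x y)\<^sup>2)"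
    unfolding einner_linear by (simp add: einner_commute[of d y x] power2_eq_square algebra_simps)
  then have "0 \<le> einner d y y * (einner d x x * einner d y y - (einner d x y)\<^sup>2)"
    using einner_self_nonneg[of d ?w] by simp
  then show ?thesis
    using pos by (simp add: zero_le_mult_iff)
qed

lemma einner_Cauchy_Schwarz:
  "\<bar>einner d x y\<bar> \<le> sqrt (einner d x x) * sqrt (einner d y y)"
  using einner_Cauchy_Schwarz_sq[of d x y]
  by (metis real_sqrt_abs real_sqrt_le_mono real_sqrt_mult)

section \<open>Coordinate functions that vanish from index d on\<close>

lemma zero_in_euc [simp]: "(\<lambda>i. 0) \<in> euc d"
  by (simp add: euc_def)

lemma euc_add: "x \<in> euc d \<Longrightarrow> y \<in> euc d \<Longrightarrow> (\<lambda>i. x i + y i) \<in> euc d"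
  by (simp add: euc_def)

lemma euc_diff: "x \<in> euc d \<Longrightarrow> y \<in> euc d \<Longrightarrow> (\<lambda>i. x i - y i) \<in> euc d"
  by (simp add: euc_def)

lemma euc_scale: "x \<in> euc d \<Longrightarrow> (\<lambda>i. k * x i) \<in> euc d"
  by (simp add: euc_def)

lemmas euc_closed = euc_add euc_diff euc_scale

lemma euc_einner_self_eq_0:
  assumes "x \<in> euc d" "einner d x x = 0"
  shows "x = (\<lambda>i. 0)"
proof
  fix i show "x i = 0"
    using assms einner_self_eq_0[of d x i] by (cases "i < d") (auto simp: euc_def)
qed

lemma euc_eqI:
  assumes "x \<in> euc d" "y \<in> euc d" "(edist d x y)\<^sup>2 \<le> 0"
  shows "x = y"
proof -
  have "einner d (\<lambda>i. x i - y i) (\<lambda>i. x i - y i) = 0"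
    using assms(3) einner_self_nonneg[of d "\<lambda>i. x i - y i"] by (simp add: edist_sq)
  then have "(\<lambda>i. x i - y i) = (\<lambda>i. 0)"
    using assms by (intro euc_einner_self_eq_0[of _ d] euc_diff)
  then show ?thesis
    by (simp add: fun_eq_iff)
qed

lemma edist_pos: "x \<in> euc d \<Longrightarrow> y \<in> euc d \<Longrightarrow> x \<noteq> y \<Longrightarrow> 0 < edist d x y"
  using euc_eqI[of x d y] edist_nonneg[of d x y]
  by (cases "edist d x y = 0") (auto simp: less_le)

lemma einner_self_pos: "x \<in> euc d \<Longrightarrow> x \<noteq> (\<lambda>i. 0) \<Longrightarrow> 0 < einner d x x"
  using euc_einner_self_eq_0[of x d] einner_self_nonneg[of d x] by force

definition unit_vec :: "nat \<Rightarrow> nat \<Rightarrow> real" where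
  "unit_vec k = (\<lambda>i. if i = k then 1 else 0)"

lemma einner_unit_vec: "k < d \<Longrightarrow> einner d (unit_vec k) x = x k"
  by (simp add: einner_def unit_vec_def if_distrib[of "\<lambda>a. a * _"] cong: if_cong)

lemma unit_vec_in_euc: "k < d \<Longrightarrow> unit_vec k \<in> euc d"
  by (simp add: euc_def unit_vec_def)

lemma unit_vec_self [simp]: "unit_vec k k = 1"
  by (simp add: unit_vec_def)

section \<open>Two balls of equal radius\<close>

text \<open>Written as a scalar multiple of a sum so that the linearity rules of
  \<open>einner\<close> apply to it.\<close>

definition midpt :: "(nat \<Rightarrow> real) \<Rightarrow> (nat \<Rightarrow> real) \<Rightarrow> nat \<Rightarrow> real" where
  "midpt x y = (\<lambda>i. (1/2) * (x i + y i))"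

lemma midpt_in_euc: "x \<in> euc d \<Longrightarrow> y \<in> euc d \<Longrightarrow> midpt x y \<in> euc d"
  unfolding midpt_def by (intro euc_closed)

text \<open>Apollonius' median formula. With both distances at most \<open>r\<close> and the centres
  at least \<open>2 * r\<close> apart, its right-hand side is at most 0.\<close>

lemma parallelogram:
  "(edist d x (midpt u v))\<^sup>2 = ((edist d x u)\<^sup>2 + (edist d x v)\<^sup>2) / 2 - (edist d u v)\<^sup>2 / 4"
  unfolding edist_expand midpt_def einner_linear by (simp add: einner_commute[of d v u] field_simps)

lemma edist_on_line:
  "(edist d (\<lambda>i. midpt u v i + t * (u i - v i)) u)\<^sup>2 = (1/2 - t)\<^sup>2 * (edist d u v)\<^sup>2"
  "(edist d (\<lambda>i. midpt u v i + t * (u i - v i)) v)\<^sup>2 = (1/2 + t)\<^sup>2 * (edist d u v)\<^sup>2"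
  unfolding edist_expand midpt_def einner_linear
  by (simp_all add: einner_commute[of d v u] power2_eq_square field_simps)

lemma edist_midpt:
  "(edist d (midpt u v) u)\<^sup>2 = (edist d u v)\<^sup>2 / 4" "(edist d (midpt u v) v)\<^sup>2 = (edist d u v)\<^sup>2 / 4"
  using edist_on_line[of d u v 0] by (simp_all add: power2_eq_square)

lemma far_balls_inter:
  assumes "u \<in> euc d" "v \<in> euc d" "x \<in> euc d" "0 \<le> r"
    and "edist d u v \<ge> 2 * r" "edist d x u \<le> r" "edist d x v \<le> r"
  shows "x = midpt u v \<and> edist d u v = 2 * r"
proof -
  have "(edist d x u)\<^sup>2 \<le> r\<^sup>2" "(edist d x v)\<^sup>2 \<le> r\<^sup>2" "(2 * r)\<^sup>2 \<le> (edist d u v)\<^sup>2"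
    using assms power_mono[of "2 * r" "edist d u v" 2] by (simp_all add: power_mono)
  then have le: "(edist d x (midpt u v))\<^sup>2 \<le> 0" and "(edist d u v)\<^sup>2 \<le> (2 * r)\<^sup>2"
    using parallelogram[of d x u v] zero_le_power2[of "edist d x (midpt u v)"]
    by (simp_all add: power_mult_distrib)
  then have "edist d u v = 2 * r"
    using assms power2_le_imp_le[of "edist d u v" "2 * r"] by simp
  moreover have "x = midpt u v"
    using assms le by (intro euc_eqI midpt_in_euc)
  ultimately show ?thesis by simp
qed

lemma midpt_in_balls:
  assumes "0 \<le> r" "edist d u v \<le> 2 * r"
  shows "edist d (midpt u v) u \<le> r" "edist d (midpt u v) v \<le> r"
  using power_mono[OF assms(2), of 2]
  unfolding edist_le_iff[OF assms(1)] edist_midpt by (simp_all add: power_mult_distrib)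

lemma midpt_in_open_balls:
  assumes "edist d u v < 2 * r"
  shows "edist d (midpt u v) u < r" "edist d (midpt u v) v < r"
proof -
  have r: "0 \<le> r" 
    using assms edist_nonneg[of d u v] by linarith
  have "(edist d u v)\<^sup>2 < (2 * r)\<^sup>2"
    using assms by (intro power_strict_mono) auto
  then show "edist d (midpt u v) u < r" "edist d (midpt u v) v < r"
    unfolding edist_less_iff[OF r] edist_midpt by (simp_all add: power_mult_distrib)
qed

lemma near_balls_not_tangent:
  assumes uv: "u \<in> euc d" "v \<in> euc d" "u \<noteq> v" and near: "edist d u v < 2 * r"
  shows "\<exists>x y. x \<noteq> y \<and> x \<in> euc d \<and> y \<in> euc d \<and> edist d x u \<le> r \<and> edist d x v \<le> r
     \<and> edist d y u \<le> r \<and> edist d y v \<le> r"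
proof -
  define D where "D = edist d u v"
  have D: "0 < D"
    using edist_pos[OF uv] by (simp add: D_def)
  have r: "D < 2 * r" "0 < r"
    using near D by (auto simp: D_def)
  \<comment> \<open>The point \<open>y\<close> below is at distance \<open>(1/2 + t) * D\<close>
    from \<open>v\<close>. This \<open>t\<close> makes the distance \<open>r\<close>, so
    \<open>y\<close> is the boundary point of the ball around \<open>v\<close> in the direction of
    \<open>u\<close>; it is a second common point besides the midpoint because
    \<open>t > 0\<close>.\<close>
  define t where "t = r / D - 1/2"
  have t: "0 < t" "(1/2 + t) * D = r"
    using D r by (simp_all add: t_def field_simps)
  define y where "y = (\<lambda>i. midpt u v i + t * (u i - v i))"
  have "\<bar>(1/2 - t) * D\<bar> \<le> (1/2 + t) * D"
    unfolding abs_mult abs_of_pos[OF D] using t D by (intro mult_right_mono) auto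
  then have "((1/2 - t) * D)\<^sup>2 \<le> r\<^sup>2"
    using t(2) by (metis abs_le_square_iff abs_of_pos r(2))
  then have "edist d y u \<le> r"
    using r edist_on_line(1)[of d u v t] edist_le_iff[of r d y u]
    by (simp add: y_def D_def power_mult_distrib)
  moreover have "edist d y v \<le> r"
    using r edist_on_line(2)[of d u v t] edist_le_iff[of r d y v]
    unfolding t(2)[symmetric] by (simp add: y_def D_def power_mult_distrib)
  moreover have "y \<in> euc d"
    unfolding y_def using uv by (intro euc_closed midpt_in_euc)
  moreover obtain i where "u i \<noteq> v i"
    using uv(3) by (auto simp: fun_eq_iff)
  then have "y i \<noteq> midpt u v i"
    using t by (simp add: y_def)
  then have "midpt u v \<noteq> y" by auto
  ultimately show ?thesis
    using midpt_in_balls[of r d u v] near r midpt_in_euc[OF uv(1,2)] by auto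
qed

lemma tangent_balls_iff:
  assumes "u \<in> euc d" "v \<in> euc d" "u \<noteq> v" "0 < r"
  shows "tangent {x \<in> euc d. edist d x u \<le> r} {x \<in> euc d. edist d x v \<le> r}
    \<longleftrightarrow> edist d u v = 2 * r"
proof
  assume tan: "tangent {x \<in> euc d. edist d x u \<le> r} {x \<in> euc d. edist d x v \<le> r}"
  then obtain x where "x \<in> euc d" "edist d x u \<le> r" "edist d x v \<le> r"
    by (auto simp: tangent_def)
  then have "\<not> edist d u v > 2 * r"
    using far_balls_inter[of u d v x r] assms by auto
  moreover have "\<not> edist d u v < 2 * r"
    using near_balls_not_tangent[of u d v r] tan assms unfolding tangent_def by blast
  ultimately show "edist d u v = 2 * r" by linarith
next
  assume "edist d u v = 2 * r"
  then show "tangent {x \<in> euc d. edist d x u \<le> r} {x \<in> euc d. edist d x v \<le> r}"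
    unfolding tangent_def using assms midpt_in_balls[of r d u v] far_balls_inter[of u d v _ r]
    by (intro ex1I[of _ "midpt u v"]) (auto simp: midpt_in_euc)
qed

section \<open>Generalised balls as sublevel sets\<close>

definition qval :: "nat \<Rightarrow> real \<Rightarrow> (nat \<Rightarrow> real) \<Rightarrow> real \<Rightarrow> (nat \<Rightarrow> real) \<Rightarrow> real" where
  "qval d A b c x = A * einner d x x - 2 * einner d b x + c"

definition gball :: "nat \<Rightarrow> real \<Rightarrow> (nat \<Rightarrow> real) \<Rightarrow> real \<Rightarrow> (nat \<Rightarrow> real) option set" where
  "gball d A b c =
     {p \<in> ext_space d. case p of None \<Rightarrow> A \<le> 0 | Some x \<Rightarrow> qval d A b c x \<le> 0}"

text \<open>A half-space, \<open>A = 0\<close>, has infinity on its boundary, so \<open>None\<close>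
  requires \<open>A < 0\<close> here.\<close>

definition gopen :: "nat \<Rightarrow> real \<Rightarrow> (nat \<Rightarrow> real) \<Rightarrow> real \<Rightarrow> (nat \<Rightarrow> real) option set" where
  "gopen d A b c =
     {p \<in> ext_space d. case p of None \<Rightarrow> A < 0 | Some x \<Rightarrow> qval d A b c x < 0}"

lemma ext_space_simps [simp]: "None \<in> ext_space d" "Some x \<in> ext_space d \<longleftrightarrow> x \<in> euc d"
  by (auto simp: ext_space_def)

lemma gball_simps [simp]:
  "None \<in> gball d A b c \<longleftrightarrow> A \<le> 0"
  "Some x \<in> gball d A b c \<longleftrightarrow> x \<in> euc d \<and> qval d A b c x \<le> 0"
  by (simp_all add: gball_def)

lemma gopen_simps [simp]:
  "None \<in> gopen d A b c \<longleftrightarrow> A < 0"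
  "Some x \<in> gopen d A b c \<longleftrightarrow> x \<in> euc d \<and> qval d A b c x < 0"
  by (simp_all add: gopen_def)

section \<open>Strict sublevel sets are open, also at infinity\<close>

lemma qval_neg_nbhd:
  assumes "qval d A b c x < 0"
  shows "\<exists>e>0. \<forall>y. edist d x y < e \<longrightarrow> qval d A b c y < 0"
proof -
  \<comment> \<open>\<open>g\<close> is half the gradient of the form at \<open>x\<close>.
    \<open>K\<close> bounds the growth per unit length for displacements of length at most 1, where
    the quadratic term is dominated by its linear counterpart; the summand 1 makes \<open>K\<close>
    positive.\<close>
  define g where "g = (\<lambda>i. A * x i - b i)"
  define K where "K = 2 * sqrt (einner d g g) + \<bar>A\<bar> + 1"
  define e where "e = min 1 (- qval d A b c x / K)"
  have K: "K > 0"
    by (simp add: K_def einner_self_nonneg add_nonneg_pos)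
  then have e: "0 < e" "e \<le> 1" "e * K \<le> - qval d A b c x"
    using assms by (auto simp: e_def field_simps min_def)
  have "qval d A b c y < 0" if y: "edist d x y < e" for y
  proof -
    define z where "z = (\<lambda>i. y i - x i)"
    define D where "D = edist d x y"
    have D: "0 \<le> D" "D < e" "einner d z z = D\<^sup>2" "sqrt (einner d z z) = D"
      using y unfolding D_def z_def edist_commute[of d x y] edist_sq
      by (simp_all add: edist_einner einner_self_nonneg)
    have "qval d A b c y = qval d A b c x + 2 * einner d g z + A * einner d z z"
      unfolding qval_def g_def z_def einner_linear
      by (simp add: einner_commute[of d y x] algebra_simps)
    also have "\<dots> \<le> qval d A b c x + 2 * (sqrt (einner d g g) * D) + \<bar>A\<bar> * D"
    proof -
      have "einner d g z \<le> sqrt (einner d g g) * D"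
        using einner_Cauchy_Schwarz[of d g z] D by simp
      moreover have "A * D\<^sup>2 \<le> \<bar>A\<bar> * D"
        using D e by (intro mult_mono) (auto simp: power2_eq_square mult_left_le_one_le)
      ultimately show ?thesis using D by simp
    qed
    also have "\<dots> \<le> qval d A b c x + D * K"
      using D by (simp add: K_def algebra_simps)
    also have "D * K < e * K"
      using D K by simp
    finally show ?thesis using e by linarith
  qed
  with e show ?thesis by blast
qed

lemma qval_neg_at_infinity:
  assumes "A < 0"
  shows "\<exists>R. \<forall>y. edist d y (\<lambda>_. 0) > R \<longrightarrow> qval d A b c y < 0"
proof -
  define B where "B = sqrt (einner d b b)"
  \<comment> \<open>The quotient is the zero of \<open>A * s + 2 * B + \<bar>c\<bar>\<close> as a
    function of \<open>s\<close>. The extra 1 forces \<open>s > 1\<close>, so that \<open>c\<close>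
    is at most \<open>s * \<bar>c\<bar>\<close> and a factor \<open>s\<close> can be taken
    out.\<close>
  define R where "R = (2 * B + \<bar>c\<bar>) / (- A) + 1"
  have B: "0 \<le> B"
    by (simp add: B_def einner_self_nonneg)
  have "qval d A b c y < 0" if y: "edist d y (\<lambda>_. 0) > R" for y
  proof -
    define s where "s = sqrt (einner d y y)"
    have s: "R < s" "einner d y y = s\<^sup>2"
      using y einner_self_nonneg[of d y] by (auto simp: s_def edist_einner)
    have "1 \<le> R" using assms B by (simp add: R_def divide_nonneg_neg divide_nonpos_neg)
    then have s1: "1 < s" using s by linarith
    have "(2 * B + \<bar>c\<bar>) / (- A) < s"
      using s by (simp add: R_def)
    then have "A * s + 2 * B + \<bar>c\<bar> < 0"
      using assms by (simp add: field_simps)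
    then have neg: "s * (A * s + 2 * B + \<bar>c\<bar>) < 0"
      using s1 by (simp add: mult_pos_neg)
    have "- einner d b y \<le> B * s"
      using einner_Cauchy_Schwarz[of d b y] by (simp add: B_def s_def)
    moreover have "c \<le> s * \<bar>c\<bar>"
      using s1 mult_right_mono[of 1 s "\<bar>c\<bar>"] by linarith
    ultimately have "qval d A b c y \<le> s * (A * s + 2 * B + \<bar>c\<bar>)"
      by (simp add: qval_def s power2_eq_square algebra_simps)
    with neg show ?thesis by linarith
  qed
  then show ?thesis by blast
qed

lemma gopen_subset_interior: "gopen d A b c \<subseteq> ext_interior d (gball d A b c)"
proof -
  have "ext_open d (gopen d A b c)"
    unfolding ext_open_def
  proof (intro conjI allI impI)
    show "gopen d A b c \<subseteq> ext_space d" by (auto simp: gopen_def)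
    show "\<exists>e>0. \<forall>y\<in>euc d. edist d x y < e \<longrightarrow> Some y \<in> gopen d A b c"
      if "Some x \<in> gopen d A b c" for x
      using that qval_neg_nbhd[of d A b c x] by auto
    show "\<exists>R. \<forall>y\<in>euc d. R < edist d y (\<lambda>_. 0) \<longrightarrow> Some y \<in> gopen d A b c"
      if "None \<in> gopen d A b c"
      using that qval_neg_at_infinity[of A d b c] by auto
  qed
  moreover have "gopen d A b c \<subseteq> gball d A b c"
    by (auto simp: gopen_def gball_def split: option.splits)
  ultimately show ?thesis
    unfolding ext_interior_def by blast
qed

lemma qval_ball: "qval d 1 u (einner d u u - r\<^sup>2) x = (edist d x u)\<^sup>2 - r\<^sup>2"
  by (simp add: qval_def edist_expand)

text \<open>The positive discriminant records nondegeneracy: it is \<open>r\<^sup>2\<close> for a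
  ball and for an exterior, and \<open>einner d a a / 4\<close> for a half-space.\<close>

lemma d_ball_gball:
  assumes "d_ball d B"
  shows "\<exists>A b c. b \<in> euc d \<and> einner d b b - A * c > 0 \<and> B = gball d A b c"
proof -
  consider u r where "u \<in> euc d" "r > 0" "B = Some ` {x \<in> euc d. edist d x u \<le> r}"
    | u r where "u \<in> euc d" "r > 0" "B = insert None (Some ` {x \<in> euc d. edist d x u \<ge> r})"
    | a h where "a \<in> euc d" "a \<noteq> (\<lambda>_. 0)" "B = insert None (Some ` {x \<in> euc d. einner d a x \<le> h})"
    using assms unfolding d_ball_def by blast
  then show ?thesis
  proof cases
    case 1
    have "B = gball d 1 u (einner d u u - r\<^sup>2)"
    proof (rule set_eqI)
      fix p show "p \<in> B \<longleftrightarrow> p \<in> gball d 1 u (einner d u u - r\<^sup>2)"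
        using 1 by (cases p) (auto simp: qval_ball)
    qed
    then show ?thesis
      using 1 by (intro exI[of _ 1] exI[of _ u] exI[of _ "einner d u u - r\<^sup>2"]) simp
  next
    case 2
    let ?b = "\<lambda>i. (-1) * u i"
    have q: "qval d (-1) ?b (r\<^sup>2 - einner d u u) x = r\<^sup>2 - (edist d x u)\<^sup>2" for x
      unfolding qval_def edist_expand einner_linear by simp
    have "B = gball d (-1) ?b (r\<^sup>2 - einner d u u)"
    proof (rule set_eqI)
      fix p show "p \<in> B \<longleftrightarrow> p \<in> gball d (-1) ?b (r\<^sup>2 - einner d u u)"
        unfolding 2(3) using 2(2) q by (cases p) auto
    qed
    moreover have "einner d ?b ?b - (-1) * (r\<^sup>2 - einner d u u) > 0"
      unfolding einner_linear using 2 by simp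
    moreover have "?b \<in> euc d"
      using 2 by (intro euc_scale)
    ultimately show ?thesis by blast
  next
    case 3
    \<comment> \<open>The factor \<open>-1/2\<close> cancels the \<open>- 2\<close> in front of the
      linear term of \<open>qval\<close>.\<close>
    let ?b = "\<lambda>i. (-1/2) * a i"
    have q: "qval d 0 ?b (- h) x = einner d a x - h" for x
      unfolding qval_def einner_linear by simp
    have "B = gball d 0 ?b (- h)"
    proof (rule set_eqI)
      fix p show "p \<in> B \<longleftrightarrow> p \<in> gball d 0 ?b (- h)"
        unfolding 3(3) using q by (cases p) auto
    qed
    moreover have "einner d a a > 0"
      using 3 euc_einner_self_eq_0[of a d] einner_self_nonneg[of d a] by fastforce
    then have "einner d ?b ?b - 0 * (- h) > 0"
      unfolding einner_linear by simp
    moreover have "?b \<in> euc d"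
      using 3 by (intro euc_scale)
    ultimately show ?thesis by blast
  qed
qed


section \<open>Inversion\<close>

text \<open>As a statement about cardinality, tangency visibly survives injective maps.\<close>

lemma tangent_card: "tangent S T \<longleftrightarrow> card (S \<inter> T) = 1"
  unfolding tangent_def One_nat_def card_1_singleton_iff set_eq_iff by (simp only: Ex1_def) blast

lemma tangent_image:
  assumes "inj_on f X" "S \<subseteq> X" "T \<subseteq> X"
  shows "tangent (f ` S) (f ` T) \<longleftrightarrow> tangent S T"
proof -
  have "f ` S \<inter> f ` T = f ` (S \<inter> T)"
    using assms by (simp add: inj_on_image_Int)
  moreover have "card (f ` (S \<inter> T)) = card (S \<inter> T)"
    using assms by (intro card_image) (auto intro: inj_on_subset)
  ultimately show ?thesis
    by (simp add: tangent_card)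
qed

text \<open>Inversion in the unit sphere around \<open>q\<close> followed by the translation taking
  \<open>q\<close> to the origin; hence infinity goes to 0. Because of the translation it need not
  be an involution, so its inverse has a definition of its own.\<close>

definition inversion ::
  "nat \<Rightarrow> (nat \<Rightarrow> real) \<Rightarrow> (nat \<Rightarrow> real) option \<Rightarrow> (nat \<Rightarrow> real) option" where
  "inversion d q p = (case p of None \<Rightarrow> Some (\<lambda>i. 0)
     | Some x \<Rightarrow> if x = q then None
         else Some (\<lambda>i. (1 / (edist d x q)\<^sup>2) * (x i - q i)))"

definition inversion_inv ::
  "nat \<Rightarrow> (nat \<Rightarrow> real) \<Rightarrow> (nat \<Rightarrow> real) option \<Rightarrow> (nat \<Rightarrow> real) option" where
  "inversion_inv d q p = (case p of None \<Rightarrow> Some q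
     | Some y \<Rightarrow> if y = (\<lambda>i. 0) then None
         else Some (\<lambda>i. q i + (1 / einner d y y) * y i))"

lemma inversion_left_inverse:
  assumes "q \<in> euc d" "p \<in> ext_space d"
  shows "inversion d q p \<in> ext_space d" "inversion_inv d q (inversion d q p) = p"
proof -
  show "inversion d q p \<in> ext_space d"
    using assms by (cases p) (auto simp: inversion_def euc_def)
  show "inversion_inv d q (inversion d q p) = p"
  proof (cases p)
    case (Some x)
    show ?thesis
    proof (cases "x = q")
      case False
      define N where "N = (edist d x q)\<^sup>2"
      have N: "N > 0"
        using assms False edist_pos[of x d q] Some by (simp add: N_def)
      let ?y = "\<lambda>i. (1 / N) * (x i - q i)"
      have yy: "einner d ?y ?y = 1 / N"
        using N unfolding einner_linear(3,6) edist_sq[symmetric] N_def[symmetric] by simp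
      then have "?y \<noteq> (\<lambda>i. 0)"
        using N by auto
      moreover have "(\<lambda>i. q i + (1 / einner d ?y ?y) * ?y i) = x"
        unfolding yy using N by (simp add: fun_eq_iff)
      moreover have "inversion d q p = Some ?y"
        using False Some by (simp add: inversion_def N_def)
      ultimately show ?thesis
        unfolding inversion_inv_def Some by simp
    qed (use Some in \<open>simp add: inversion_def inversion_inv_def\<close>)
  qed (simp add: inversion_def inversion_inv_def)
qed

lemma inversion_right_inverse:
  assumes "q \<in> euc d" "p \<in> ext_space d"
  shows "inversion_inv d q p \<in> ext_space d" "inversion d q (inversion_inv d q p) = p"
proof -
  show "inversion_inv d q p \<in> ext_space d"
    using assms by (cases p) (auto simp: inversion_inv_def euc_def)
  show "inversion d q (inversion_inv d q p) = p"
  proof (cases p)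
    case (Some y)
    show ?thesis
    proof (cases "y = (\<lambda>i. 0)")
      case False
      define N where "N = einner d y y"
      have N: "N > 0"
        using assms False einner_self_pos[of y d] Some by (simp add: N_def)
      let ?x = "\<lambda>i. q i + (1 / N) * y i"
      have "(\<lambda>i. ?x i - q i) = (\<lambda>i. (1 / N) * y i)"
        by simp
      then have xq: "(edist d ?x q)\<^sup>2 = 1 / N"
        using N unfolding edist_sq by (simp only: einner_linear N_def[symmetric]) simp
      have "?x \<noteq> q"
        using False N by (auto simp: fun_eq_iff)
      moreover have "(\<lambda>i. (1 / (edist d ?x q)\<^sup>2) * (?x i - q i)) = y"
        unfolding xq using N by (simp add: fun_eq_iff)
      moreover have "inversion_inv d q p = Some ?x"
        using False Some by (simp add: inversion_inv_def N_def)
      ultimately show ?thesis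
        unfolding inversion_def Some by simp
    qed (use Some in \<open>simp add: inversion_def inversion_inv_def\<close>)
  qed (simp add: inversion_def inversion_inv_def)
qed

lemma bij_inversion: "q \<in> euc d \<Longrightarrow> bij_betw (inversion d q) (ext_space d) (ext_space d)"
  by (rule bij_betw_byWitness[where f' = "inversion_inv d q"])
    (auto simp: inversion_left_inverse inversion_right_inverse)

text \<open>Up to the translation moving \<open>q\<close> to the origin, inversion swaps the coefficient of the square
  norm with the constant coefficient.\<close>

lemma qval_inversion:
  assumes "x \<in> euc d" "q \<in> euc d" "x \<noteq> q"
  shows "qval d (qval d A b c q) (\<lambda>i. b i - A * q i) A (\<lambda>i. (1 / (edist d x q)\<^sup>2) * (x i - q i))
    = qval d A b c x / (edist d x q)\<^sup>2"
proof -
  define N where "N = (edist d x q)\<^sup>2"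
  have N: "N > 0"
    using assms edist_pos[of x d q] by (simp add: N_def)
  have N': "N = einner d x x - 2 * einner d q x + einner d q q"
    by (simp add: N_def edist_expand)
  have yy: "einner d (\<lambda>i. (1 / N) * (x i - q i)) (\<lambda>i. (1 / N) * (x i - q i)) = 1 / N"
    using N unfolding einner_linear(3,6) edist_sq[symmetric] N_def[symmetric] by simp
  have "qval d (qval d A b c q) (\<lambda>i. b i - A * q i) A (\<lambda>i. (1 / N) * (x i - q i))
      = qval d A b c q / N - 2 / N * einner d (\<lambda>i. b i - A * q i) (\<lambda>i. x i - q i) + A"
    by (simp only: qval_def[of d "qval d A b c q"] yy einner_scale_right[of d _ _ "\<lambda>i. x i - q i"]) simp
  also have "\<dots> = (qval d A b c q - 2 * einner d (\<lambda>i. b i - A * q i) (\<lambda>i. x i - q i) + A * N) / N"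
    using N by (simp add: field_simps)
  also have "qval d A b c q - 2 * einner d (\<lambda>i. b i - A * q i) (\<lambda>i. x i - q i) + A * N
      = qval d A b c x"
    unfolding N' qval_def einner_linear by (simp add: algebra_simps)
  finally show ?thesis
    by (simp add: N_def)
qed

lemma bij_betw_image_eqI:
  assumes "bij_betw f X X" "S \<subseteq> X" "T \<subseteq> X" "\<And>p. p \<in> X \<Longrightarrow> f p \<in> T \<longleftrightarrow> p \<in> S"
  shows "T = f ` S"
proof
  have "X = f ` X"
    using assms(1) by (simp add: bij_betw_def)
  then show "T \<subseteq> f ` S"
    using assms(3,4) by fast
  show "f ` S \<subseteq> T"
    using assms(2,4) by auto
qed

text \<open>Away from the two exceptional points the form is divided by a positive number, which
  keeps its sign. \<open>None\<close> goes to the origin, where the new form equals its constant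
  coefficient \<open>A\<close>; \<open>Some q\<close> goes to \<open>None\<close>, where membership
  depends on the new leading coefficient, the old value at \<open>q\<close>.\<close>

lemma
  assumes q: "q \<in> euc d"
  shows gball_inversion:
      "gball d (qval d A b c q) (\<lambda>i. b i - A * q i) A = inversion d q ` gball d A b c"
    and gopen_inversion:
      "gopen d (qval d A b c q) (\<lambda>i. b i - A * q i) A = inversion d q ` gopen d A b c"
proof -
  have at_zero: "qval d A' b' c' (\<lambda>i. 0) = c'" for A' b' c'
    by (simp add: qval_def)
  have inv: "\<exists>y\<in>euc d. inversion d q (Some x) = Some y
      \<and> (qval d (qval d A b c q) (\<lambda>i. b i - A * q i) A y \<le> 0 \<longleftrightarrow> qval d A b c x \<le> 0)
      \<and> (qval d (qval d A b c q) (\<lambda>i. b i - A * q i) A y < 0 \<longleftrightarrow> qval d A b c x < 0)"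
    if "x \<in> euc d" "x \<noteq> q" for x
  proof (intro bexI conjI)
    let ?y = "\<lambda>i. (1 / (edist d x q)\<^sup>2) * (x i - q i)"
    show "inversion d q (Some x) = Some ?y"
      using that by (simp add: inversion_def)
    show "qval d (qval d A b c q) (\<lambda>i. b i - A * q i) A ?y \<le> 0 \<longleftrightarrow> qval d A b c x \<le> 0"
      "qval d (qval d A b c q) (\<lambda>i. b i - A * q i) A ?y < 0 \<longleftrightarrow> qval d A b c x < 0"
      unfolding qval_inversion[OF that(1) q that(2)]
      using edist_pos[OF that(1) q that(2)] by (auto simp: divide_le_0_iff divide_less_0_iff)
    show "?y \<in> euc d"
      using that q by (intro euc_closed)
  qed
  have at_special: "inversion d q None = Some (\<lambda>i. 0)" "inversion d q (Some q) = None"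
    by (simp_all add: inversion_def)
  show "gball d (qval d A b c q) (\<lambda>i. b i - A * q i) A = inversion d q ` gball d A b c"
  proof (rule bij_betw_image_eqI[OF bij_inversion[OF q]])
    fix p assume p: "p \<in> ext_space d"
    show "inversion d q p \<in> gball d (qval d A b c q) (\<lambda>i. b i - A * q i) A
        \<longleftrightarrow> p \<in> gball d A b c"
    proof (cases "p = None \<or> p = Some q")
      case True
      then show ?thesis by (elim disjE) (simp_all add: q at_special at_zero)
    next
      case False
      then obtain x where x: "p = Some x" "x \<in> euc d" "x \<noteq> q"
        using p by (cases p) auto
      with inv[of x] show ?thesis by auto
    qed
  qed (auto simp: gball_def)
  show "gopen d (qval d A b c q) (\<lambda>i. b i - A * q i) A = inversion d q ` gopen d A b c"
  proof (rule bij_betw_image_eqI[OF bij_inversion[OF q]])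
    fix p assume p: "p \<in> ext_space d"
    show "inversion d q p \<in> gopen d (qval d A b c q) (\<lambda>i. b i - A * q i) A
        \<longleftrightarrow> p \<in> gopen d A b c"
    proof (cases "p = None \<or> p = Some q")
      case True
      then show ?thesis by (elim disjE) (simp_all add: q at_special at_zero)
    next
      case False
      then obtain x where x: "p = Some x" "x \<in> euc d" "x \<noteq> q"
        using p by (cases p) auto
      with inv[of x] show ?thesis by auto
    qed
  qed (auto simp: gopen_def)
qed

text \<open>A packing in terms of coefficients. Disjointness is required of the sets
  \<open>gopen\<close>, because inversion transports them exactly.\<close>

definition gball_family ::
  "nat \<Rightarrow> 'w set \<Rightarrow> ('w \<Rightarrow> real) \<Rightarrow> ('w \<Rightarrow> nat \<Rightarrow> real) \<Rightarrow> ('w \<Rightarrow> real) \<Rightarrow> bool" where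
  "gball_family d W A b c \<longleftrightarrow>
     (\<forall>v\<in>W. b v \<in> euc d \<and> einner d (b v) (b v) - A v * c v > 0)
   \<and> (\<forall>u\<in>W. \<forall>v\<in>W. u \<noteq> v \<longrightarrow> gopen d (A u) (b u) (c u) \<inter> gopen d (A v) (b v) (c v) = {})"

lemma gball_family_common_point_to_infinity:
  assumes fam: "gball_family d W A b c"
    and p: "p \<in> gball d (A u0) (b u0) (c u0)" "p \<in> gball d (A u1) (b u1) (c u1)"
  obtains A' b' c' where "gball_family d W A' b' c'" "A' u0 \<le> 0" "A' u1 \<le> 0"
    "\<And>u v. tangent (gball d (A' u) (b' u) (c' u)) (gball d (A' v) (b' v) (c' v))
      \<longleftrightarrow> tangent (gball d (A u) (b u) (c u)) (gball d (A v) (b v) (c v))"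
proof (cases p)
  case None
  with assms show ?thesis by (intro that[of A b c]) auto
next
  case (Some q)
  then have q: "q \<in> euc d" using p by simp
  let ?A' = "\<lambda>v. qval d (A v) (b v) (c v) q" and ?b' = "\<lambda>v i. b v i - A v * q i"
  have inj: "inj_on (inversion d q) (ext_space d)"
    using bij_inversion[OF q] by (simp add: bij_betw_def)
  \<comment> \<open>The discriminant does not change under the translation by \<open>q\<close> and
    is symmetric in the two coefficients that inversion swaps.\<close>
  have disc: "einner d (?b' v) (?b' v) - ?A' v * A v = einner d (b v) (b v) - A v * c v" for v
    unfolding qval_def einner_linear by (simp add: einner_commute[of d q "b v"] algebra_simps)
  show ?thesis
  proof (rule that[of ?A' ?b' A])
    show "gball_family d W ?A' ?b' A"
      unfolding gball_family_def disc
    proof (intro conjI ballI impI)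
      fix u v assume uv: "u \<in> W" "v \<in> W" "u \<noteq> v"
      have "inversion d q ` gopen d (A u) (b u) (c u) \<inter> inversion d q ` gopen d (A v) (b v) (c v)
        = inversion d q ` (gopen d (A u) (b u) (c u) \<inter> gopen d (A v) (b v) (c v))"
        by (rule inj_on_image_Int[OF inj, symmetric]) (auto simp: gopen_def)
      then show "gopen d (?A' u) (?b' u) (A u) \<inter> gopen d (?A' v) (?b' v) (A v) = {}"
        unfolding gopen_inversion[OF q] using fam uv by (simp add: gball_family_def)
    qed (use fam q in \<open>auto simp: gball_family_def intro!: euc_closed\<close>)
    show "?A' u0 \<le> 0" "?A' u1 \<le> 0"
      using p Some by auto
    show "tangent (gball d (?A' u) (?b' u) (A u)) (gball d (?A' v) (?b' v) (A v))
      \<longleftrightarrow> tangent (gball d (A u) (b u) (c u)) (gball d (A v) (b v) (c v))" for u v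
      unfolding gball_inversion[OF q] by (rule tangent_image[OF inj]) (auto simp: gball_def)
  qed
qed

section \<open>Balls between parallel hyperplanes\<close>

text \<open>Far enough along \<open>b'\<close>, which points into the half-space, a point is inside
  both sets.\<close>

lemma halfspace_meets_exterior:
  assumes "A < 0" "b' \<in> euc d" "einner d b' b' > 0"
  shows "\<exists>x\<in>euc d. qval d A b c x < 0 \<and> qval d 0 b' c' x < 0"
proof -
  obtain R where R: "\<And>y. edist d y (\<lambda>_. 0) > R \<Longrightarrow> qval d A b c y < 0"
    using qval_neg_at_infinity[OF assms(1), of d b c] by blast
  define s where "s = einner d b' b'"
  have s: "s > 0" using assms by (simp add: s_def)
  \<comment> \<open>The first summand pushes the length of \<open>t * b'\<close> beyond
    \<open>R\<close>, the second pushes \<open>t * s\<close> beyond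
    \<open>\<bar>c'\<bar>\<close>.\<close>
  define t where "t = (\<bar>R\<bar> + 1) / sqrt s + (\<bar>c'\<bar> + 1) / s"
  have t: "t \<ge> (\<bar>R\<bar> + 1) / sqrt s" "t \<ge> (\<bar>c'\<bar> + 1) / s"
    using s by (simp_all add: t_def)
  then have t': "t * sqrt s \<ge> \<bar>R\<bar> + 1" "t * s \<ge> \<bar>c'\<bar> + 1"
    using s by (simp_all add: pos_divide_le_eq)
  have "0 \<le> t" using s by (simp add: t_def)
  let ?x = "\<lambda>i. t * b' i"
  have "einner d ?x ?x = t\<^sup>2 * s"
    unfolding einner_linear s_def by (simp add: power2_eq_square)
  then have "edist d ?x (\<lambda>_. 0) = t * sqrt s"
    using \<open>0 \<le> t\<close> by (simp add: edist_einner real_sqrt_mult)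
  then have "qval d A b c ?x < 0"
    using t' by (intro R) linarith
  moreover have "qval d 0 b' c' ?x = c' - 2 * (t * s)"
    unfolding qval_def einner_linear s_def by simp
  then have "qval d 0 b' c' ?x < 0"
    using t' by linarith
  ultimately show ?thesis
    using assms euc_scale by blast
qed

text \<open>\<open>b\<close> and \<open>b'\<close> point into their half-spaces and \<open>y\<close>
  bisects the angle between them. Its inner products with both are positive multiples of
  \<open>g\<close>, so with \<open>g > 0\<close> a far point along \<open>y\<close> would lie inside
  both. The remaining case \<open>g = 0\<close> is equality in Cauchy-Schwarz and makes
  \<open>y\<close> vanish. The conclusion pairs this vector equation with an arbitrary
  \<open>z\<close>.\<close>

lemma disjoint_halfspaces_antiparallel:
  assumes b: "b \<in> euc d" "einner d b b > 0" "b' \<in> euc d" "einner d b' b' > 0"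
    and disj: "\<And>x. x \<in> euc d \<Longrightarrow> \<not> (qval d 0 b c x < 0 \<and> qval d 0 b' c' x < 0)"
  shows "sqrt (einner d b' b') * einner d b z = - sqrt (einner d b b) * einner d b' z"
proof -
  define s s' where "s = sqrt (einner d b b)" and "s' = sqrt (einner d b' b')"
  have s: "s > 0" "s' > 0" "einner d b b = s * s" "einner d b' b' = s' * s'"
    using b by (simp_all add: s_def s'_def)
  define g where "g = s * s' + einner d b b'"
  define y where "y = (\<lambda>i. s' * b i + s * b' i)"
  have ip_y: "einner d b y = s * g" "einner d b' y = s' * g"
    unfolding y_def einner_linear einner_commute[of d b' b] g_def s
    by (simp_all add: algebra_simps)
  have "g = 0"
  proof (rule ccontr)
    assume "g \<noteq> 0"
    then have g: "g > 0"
      using einner_Cauchy_Schwarz[of d b b'] by (simp add: g_def s_def s'_def)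
    define t where "t = \<bar>c\<bar> / (s * g) + \<bar>c'\<bar> / (s' * g) + 1"
    have pos: "s * g > 0" "s' * g > 0" using s g by auto
    have "t > \<bar>c\<bar> / (s * g)" "t > \<bar>c'\<bar> / (s' * g)"
      using pos by (simp_all add: t_def add_pos_nonneg add_nonneg_pos)
    then have "t * (s * g) > \<bar>c\<bar>" "t * (s' * g) > \<bar>c'\<bar>"
      using pos by (simp_all only: pos_divide_less_eq)
    then have "qval d 0 b c (\<lambda>i. t * y i) < 0 \<and> qval d 0 b' c' (\<lambda>i. t * y i) < 0"
      unfolding qval_def einner_scale_right ip_y by linarith
    moreover have "(\<lambda>i. t * y i) \<in> euc d"
      unfolding y_def using b by (intro euc_closed)
    ultimately show False using disj by blast
  qed
  then have "einner d y y = 0"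
    using ip_y y_def einner_add_left[of d "\<lambda>i. s' * b i" "\<lambda>i. s * b' i" y]
    by (simp add: einner_scale_left)
  then have "einner d y z = 0"
    by (rule einner_eq_0_left)
  then show ?thesis
    unfolding y_def einner_linear s_def s'_def by simp
qed

text \<open>A common point gives one inequality by Cauchy-Schwarz. Disjoint interiors give the
  other, tested on the points \<open>m + t * n\<close> of the radius that heads for the
  wall.\<close>

lemma ball_halfspace_contact:
  assumes n: "n \<in> euc d" "einner d n n = 1" and m: "m \<in> euc d" and r: "0 < r"
    and disj: "\<And>x. x \<in> euc d \<Longrightarrow> edist d x m < r \<Longrightarrow> \<not> einner d n x > h"
    and meet: "edist d x0 m \<le> r" "einner d n x0 \<ge> h"
  shows "einner d n m + r = h"
proof (rule antisym)
  have "\<bar>einner d n (\<lambda>i. x0 i - m i)\<bar> \<le> edist d x0 m"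
    using einner_Cauchy_Schwarz[of d n "\<lambda>i. x0 i - m i"] n by (simp add: edist_einner)
  then show "h \<le> einner d n m + r"
    using meet unfolding einner_linear by linarith
  show "einner d n m + r \<le> h"
  proof (rule ccontr)
    assume "\<not> einner d n m + r \<le> h"
    then have "max 0 (h - einner d n m) < r" using r by auto
    then obtain t where t: "0 < t" "h - einner d n m < t" "t < r"
      using dense[of "max 0 (h - einner d n m)" r] by auto
    let ?x = "\<lambda>i. m i + t * n i"
    have "(edist d ?x m)\<^sup>2 = t\<^sup>2"
      unfolding edist_sq by (simp add: einner_linear n power2_eq_square)
    then have "edist d ?x m < r"
      using t by (simp add: power2_eq_iff_nonneg)
    moreover have "einner d n ?x > h"
      unfolding einner_linear using t n by simp
    moreover have "?x \<in> euc d"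
      using n m by (intro euc_closed)
    ultimately show False using disj by blast
  qed
qed


text \<open>The signs of the leading coefficients are settled by exclusion: two negative ones share
  infinity, a negative one and a zero one overlap far out, and three zero ones contradict
  antiparallelism. So \<open>u0\<close> and \<open>u1\<close> have coefficient 0 and all others are
  positive. Contact with both walls then leaves no freedom in radius and height.\<close>

lemma gball_family_strip:
  assumes fam: "gball_family d W A b c"
    and u: "u0 \<in> W" "u1 \<in> W" "u0 \<noteq> u1" and inf: "A u0 \<le> 0" "A u1 \<le> 0"
    and meet: "\<And>v w. v \<in> W - {u0, u1} \<Longrightarrow> w \<in> {u0, u1} \<Longrightarrow>
      gball d (A v) (b v) (c v) \<inter> gball d (A w) (b w) (c w) \<noteq> {}"
    and ne: "W - {u0, u1} \<noteq> {}"
  obtains n r k m where "n \<in> euc d" "einner d n n = 1" "0 < r"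
    "\<And>v. v \<in> W - {u0, u1} \<Longrightarrow> m v \<in> euc d \<and> einner d n (m v) = k
       \<and> gball d (A v) (b v) (c v) = Some ` {x \<in> euc d. edist d x (m v) \<le> r}
       \<and> gopen d (A v) (b v) (c v) = Some ` {x \<in> euc d. edist d x (m v) < r}"
proof -
  have b_euc: "b v \<in> euc d" and disc: "einner d (b v) (b v) - A v * c v > 0" if "v \<in> W" for v
    using fam that by (auto simp: gball_family_def)
  have disj: "\<not> (qval d (A v) (b v) (c v) x < 0 \<and> qval d (A w) (b w) (c w) x < 0)"
    if "v \<in> W" "w \<in> W" "v \<noteq> w" "x \<in> euc d" for v w x
    using fam that unfolding gball_family_def by (metis IntI empty_iff gopen_simps(2))
  have not_both_neg: "\<not> (A v < 0 \<and> A w < 0)" if "v \<in> W" "w \<in> W" "v \<noteq> w" for v w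
    using fam that unfolding gball_family_def by (metis IntI empty_iff gopen_simps(1))
  have not_neg: "\<not> A v < 0" if vw: "v \<in> W" "w \<in> W" "v \<noteq> w" "A w = 0" for v w
  proof
    assume neg: "A v < 0"
    have "einner d (b w) (b w) > 0"
      using disc[of w] that by simp
    then obtain x where "x \<in> euc d" "qval d (A v) (b v) (c v) x < 0" "qval d 0 (b w) (c w) x < 0"
      using halfspace_meets_exterior[OF neg b_euc[OF vw(2)]] by blast
    then show False using disj[of v w x] that by simp
  qed
  have A0: "A u0 = 0" "A u1 = 0"
    using not_both_neg[of u0 u1] not_neg[of u0 u1] not_neg[of u1 u0] u inf by force+
  define s where "s = (\<lambda>v. sqrt (einner d (b v) (b v)))"
  have s: "s v > 0" "s v * s v = einner d (b v) (b v)" if "v \<in> W" "A v = 0" for v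
    using disc[OF that(1)] that by (simp_all add: s_def)
  have anti: "s w * einner d (b v) z = - s v * einner d (b w) z"
    if "v \<in> W" "w \<in> W" "v \<noteq> w" "A v = 0" "A w = 0" for v w z
    unfolding s_def
    using disjoint_halfspaces_antiparallel[of "b v" d "b w" "c v" "c w" z]
      b_euc[OF that(1)] b_euc[OF that(2)] disc[OF that(1)] disc[OF that(2)] disj[OF that(1-3)] that
    by simp
  have A_pos: "A v > 0" if v: "v \<in> W - {u0, u1}" for v
  proof (rule ccontr)
    assume "\<not> A v > 0"
    then have Av: "A v = 0"
      using not_neg[of v u0] u v A0 by force
    \<comment> \<open>Three pairwise antiparallel vectors would include a parallel pair.\<close>
    let ?z = "b v"
    have pos: "einner d (b v) ?z > 0" "s u0 > 0" "s u1 > 0" "s v > 0"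
      using s[of v] s[of u0] s[of u1] disc[of v] u v A0 Av by auto
    have "einner d (b w) ?z < 0" if "w \<in> {u0, u1}" for w
    proof -
      have "0 < s w * einner d (b v) ?z"
        using pos that by auto
      also have "\<dots> = - s v * einner d (b w) ?z"
        using anti[of v w ?z] that u v A0 Av by auto
      finally show ?thesis
        using pos by (simp add: mult_less_0_iff)
    qed
    then have "s u1 * einner d (b u0) ?z < 0" "s u0 * einner d (b u1) ?z < 0"
      using pos by (simp_all add: mult_pos_neg)
    then show False
      using anti[OF u A0, of ?z] by simp
  qed
  define n where "n = (\<lambda>i. (1 / s u0) * b u0 i)"
  have n: "n \<in> euc d" "einner d n n = 1"
    using s[OF u(1) A0(1)] b_euc[OF u(1)] unfolding n_def einner_linear
    by (auto simp: euc_def field_simps)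
  \<comment> \<open>\<open>n\<close> points into the wall of \<open>u0\<close> and \<open>n'\<close>
    into that of \<open>u1\<close>. With the walls written as \<open>einner d n x \<ge> h0\<close>
    and \<open>einner d n' x \<ge> h1\<close>, one contact lemma serves both.\<close>
  define n' where "n' = (\<lambda>i. (-1) * n i)"
  have n': "n' \<in> euc d" "einner d n' n' = 1" "einner d n' x = - einner d n x" for x
    using n unfolding n'_def einner_linear by (auto simp: euc_def)
  have b0: "einner d (b u0) x = s u0 * einner d n x" for x
    using s[OF u(1) A0(1)] unfolding n_def einner_linear by simp
  have b1: "einner d (b u1) x = s u1 * einner d n' x" for x
  proof -
    have "s u0 * (einner d (b u1) x + s u1 * einner d n x) = 0"
      using anti[OF u A0, of x] unfolding b0 by (simp add: algebra_simps)
    then show ?thesis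
      using s(1)[OF u(1) A0(1)] unfolding n'(3) by simp
  qed
  define h0 h1 where "h0 = c u0 / (2 * s u0)" and "h1 = c u1 / (2 * s u1)"
  have q0: "qval d (A u0) (b u0) (c u0) x = 2 * s u0 * (h0 - einner d n x)" for x
    using s[OF u(1) A0(1)] by (simp add: qval_def A0 b0 h0_def field_simps)
  have q1: "qval d (A u1) (b u1) (c u1) x = 2 * s u1 * (h1 - einner d n' x)" for x
    using s[OF u(2) A0(2)] by (simp add: qval_def A0 b1 h1_def field_simps)
  \<comment> \<open>Centre and radius are read off by completing the square.\<close>
  define m where "m = (\<lambda>v i. (1 / A v) * b v i)"
  define r where "r = (\<lambda>v. sqrt (einner d (b v) (b v) - A v * c v) / A v)"
  have m_euc: "m v \<in> euc d" if "v \<in> W" for v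
    unfolding m_def using b_euc[OF that] by (rule euc_scale)
  have r_pos: "r v > 0" if "v \<in> W - {u0, u1}" for v
    using A_pos[OF that] disc[of v] that by (simp add: r_def)
  have qv: "qval d (A v) (b v) (c v) x = A v * ((edist d x (m v))\<^sup>2 - (r v)\<^sup>2)"
    if v: "v \<in> W - {u0, u1}" for v x
  proof -
    have r2: "(r v)\<^sup>2 = (einner d (b v) (b v) - A v * c v) / (A v)\<^sup>2"
      using disc[of v] v by (simp add: r_def power_divide)
    show ?thesis
      using A_pos[OF v] unfolding r2 edist_expand m_def einner_linear qval_def
      by (simp add: field_simps power2_eq_square)
  qed
  have qv_le: "qval d (A v) (b v) (c v) x \<le> 0 \<longleftrightarrow> edist d x (m v) \<le> r v"
    and qv_less: "qval d (A v) (b v) (c v) x < 0 \<longleftrightarrow> edist d x (m v) < r v"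
    if v: "v \<in> W - {u0, u1}" for v x
    using A_pos[OF v] r_pos[OF v] edist_le_iff[of "r v" d x "m v"] edist_less_iff[of "r v" d x "m v"]
    by (simp_all add: qv[OF v] mult_le_0_iff mult_less_0_iff)
  \<comment> \<open>The common point is finite, since \<open>A v > 0\<close> keeps infinity out of
    the ball.\<close>
  have meet': "\<exists>x. qval d (A v) (b v) (c v) x \<le> 0 \<and> qval d (A w) (b w) (c w) x \<le> 0"
    if v: "v \<in> W - {u0, u1}" and w: "w \<in> {u0, u1}" for v w
  proof -
    obtain p where "p \<in> gball d (A v) (b v) (c v)" "p \<in> gball d (A w) (b w) (c w)"
      using meet[OF v w] by blast
    then show ?thesis
      using A_pos[OF v] by (cases p) auto
  qed
  have contact: "einner d n (m v) + r v = h0" "einner d n' (m v) + r v = h1"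
    if v: "v \<in> W - {u0, u1}" for v
  proof -
    have vW: "v \<in> W" "v \<noteq> u0" "v \<noteq> u1" using v by auto
    obtain x where "edist d x (m v) \<le> r v" "einner d n x \<ge> h0"
      using meet'[OF v, of u0] s(1)[OF u(1) A0(1)] by (auto simp: qv_le[OF v] q0 mult_le_0_iff)
    then show "einner d n (m v) + r v = h0"
      using disj[OF vW(1) u(1) vW(2)] s(1)[OF u(1) A0(1)]
      by (intro ball_halfspace_contact[OF n m_euc[OF vW(1)] r_pos[OF v]])
        (auto simp: qv_less[OF v] q0 mult_less_0_iff)
    obtain x where "edist d x (m v) \<le> r v" "einner d n' x \<ge> h1"
      using meet'[OF v, of u1] s(1)[OF u(2) A0(2)] by (auto simp: qv_le[OF v] q1 mult_le_0_iff)
    then show "einner d n' (m v) + r v = h1"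
      using disj[OF vW(1) u(2) vW(3)] s(1)[OF u(2) A0(2)]
      by (intro ball_halfspace_contact[OF n'(1,2) m_euc[OF vW(1)] r_pos[OF v]])
        (auto simp: qv_less[OF v] q1 mult_less_0_iff)
  qed
  \<comment> \<open>Half the sum and half the difference of the two contact equations.\<close>
  have rv: "r v = (h0 + h1) / 2" and nm: "einner d n (m v) = (h0 - h1) / 2"
    if v: "v \<in> W - {u0, u1}" for v
    using contact[OF v] unfolding n'(3) by simp_all
  show ?thesis
  proof (rule that[OF n])
    \<comment> \<open>Positivity comes from an actual ball between the walls, whose radius this
      is.\<close>
    show "0 < (h0 + h1) / 2"
      using ne rv r_pos by fastforce
    fix v assume v: "v \<in> W - {u0, u1}"
    have ball: "gball d (A v) (b v) (c v) = Some ` {x \<in> euc d. edist d x (m v) \<le> r v}"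
    proof (rule set_eqI)
      fix p show "p \<in> gball d (A v) (b v) (c v)
          \<longleftrightarrow> p \<in> Some ` {x \<in> euc d. edist d x (m v) \<le> r v}"
        using A_pos[OF v] qv_le[OF v] by (cases p) auto
    qed
    have "gopen d (A v) (b v) (c v) = Some ` {x \<in> euc d. edist d x (m v) < r v}"
    proof (rule set_eqI)
      fix p show "p \<in> gopen d (A v) (b v) (c v)
          \<longleftrightarrow> p \<in> Some ` {x \<in> euc d. edist d x (m v) < r v}"
        using A_pos[OF v] qv_less[OF v] by (cases p) auto
    qed
    then show "m v \<in> euc d \<and> einner d n (m v) = (h0 - h1) / 2
       \<and> gball d (A v) (b v) (c v) = Some ` {x \<in> euc d. edist d x (m v) \<le> (h0 + h1) / 2}
       \<and> gopen d (A v) (b v) (c v) = Some ` {x \<in> euc d. edist d x (m v) < (h0 + h1) / 2}"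
      using ball m_euc nm[OF v] rv[OF v] v by auto
  qed
qed

section \<open>Lowering the dimension by one\<close>

lemma edist_Suc: "(edist (Suc n) x y)\<^sup>2 = (edist n x y)\<^sup>2 + (x n - y n)\<^sup>2"
  by (simp add: edist_def sum_nonneg)

text \<open>The isometry is the reflection exchanging \<open>n\<close> with the last standard basis vector. When the two
  coincide, the division by zero turns it into the identity.\<close>

lemma hyperplane_isometry:
  assumes n: "einner (Suc k) n n = 1"
  obtains H where "\<And>x y. einner (Suc k) n x = einner (Suc k) n y \<Longrightarrow>
    edist k (H x) (H y) = edist (Suc k) x y"
proof -
  let ?d = "Suc k"
  define w where "w = (\<lambda>i. n i - unit_vec k i)"
  define H where "H = (\<lambda>x i. x i - (2 * einner ?d w x / einner ?d w w) * w i)"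
  have e: "einner ?d (unit_vec k) x = x k" for x
    by (simp add: einner_unit_vec)
  have wx: "einner ?d w x = einner ?d n x - x k" for x
    unfolding w_def einner_linear e by simp
  have wk: "w k = n k - 1"
    by (simp add: w_def)
  have ww: "einner ?d w w = - 2 * w k"
    unfolding wx[of w] wk unfolding w_def einner_linear
    by (simp add: n einner_commute[of ?d n "unit_vec k"] e)
  have "edist k (H x) (H y) = edist ?d x y" if eq: "einner ?d n x = einner ?d n y" for x y
  proof -
    define z where "z = (\<lambda>i. x i - y i)"
    have nz: "einner ?d n z = 0"
      unfolding z_def einner_linear using eq by simp
    define t where "t = 2 * einner ?d w z / einner ?d w w"
    have Hz: "H x i - H y i = z i - t * w i" for i
      unfolding H_def t_def z_def einner_linear by (simp add: diff_divide_distrib algebra_simps)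
    \<comment> \<open>This also holds when \<open>w\<close> has norm 0, as both sides are then
      0.\<close>
    have t: "t * einner ?d w w = 2 * einner ?d w z"
      using einner_eq_0_left[of ?d w z] by (simp add: t_def)
    have "(edist ?d (H x) (H y))\<^sup>2 = einner ?d z z - t * (2 * einner ?d w z) + t * (t * einner ?d w w)"
      unfolding edist_sq Hz einner_linear by (simp add: einner_commute[of ?d z w] algebra_simps)
    also have "\<dots> = (edist ?d x y)\<^sup>2"
      by (simp add: t edist_sq z_def)
    finally have iso: "(edist ?d (H x) (H y))\<^sup>2 = (edist ?d x y)\<^sup>2" .
    \<comment> \<open>From \<open>einner ?d w w = - 2 * w k\<close> and
      \<open>einner ?d n z = 0\<close> one gets \<open>t * w k = z k\<close>. So \<open>H\<close>
      makes the hyperplane horizontal, and the last coordinate contributes nothing to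
      distances.\<close>
    have "H x k - H y k = 0"
      unfolding Hz using t ww wx[of z] nz by simp
    then have "(edist k (H x) (H y))\<^sup>2 = (edist ?d x y)\<^sup>2"
      using iso edist_Suc[of k "H x" "H y"] by simp
    then show ?thesis
      by (simp add: power2_eq_iff_nonneg)
  qed
  then show ?thesis by (rule that)
qed

lemma edist_scaled_restrict:
  assumes "0 < r"
  shows "edist k (\<lambda>i. if i < k then x i / r else 0) (\<lambda>i. if i < k then y i / r else 0)
    = edist k x y / r"
proof -
  have "(\<Sum>i<k. ((if i < k then x i / r else 0) - (if i < k then y i / r else 0))\<^sup>2)
      = (\<Sum>i<k. (x i - y i)\<^sup>2) / r\<^sup>2"
    unfolding sum_divide_distrib
    by (rule sum.cong) (auto simp: power_divide simp flip: diff_divide_distrib)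
  then show ?thesis
    using assms by (simp add: edist_def real_sqrt_divide)
qed

text \<open>The common normal form of both sides of the equivalence. It constrains
  \<open>adj\<close> on distinct vertices only and does not tell fixed balls from the
  others.\<close>

definition contact_centers ::
  "nat \<Rightarrow> 'w set \<Rightarrow> ('w \<Rightarrow> 'w \<Rightarrow> bool) \<Rightarrow> ('w \<Rightarrow> nat \<Rightarrow> real) \<Rightarrow> bool" where
  "contact_centers k W adj m \<longleftrightarrow> (\<forall>v\<in>W. m v \<in> euc k)
     \<and> (\<forall>u\<in>W. \<forall>v\<in>W. u \<noteq> v \<longrightarrow>
          edist k (m u) (m v) \<ge> 2 \<and> (edist k (m u) (m v) = 2 \<longleftrightarrow> adj u v))"

lemma contact_centersD:
  assumes "contact_centers k W adj m"
  shows "v \<in> W \<Longrightarrow> m v \<in> euc k"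
    and "u \<in> W \<Longrightarrow> v \<in> W \<Longrightarrow> u \<noteq> v \<Longrightarrow> edist k (m u) (m v) \<ge> 2"
    and "u \<in> W \<Longrightarrow> v \<in> W \<Longrightarrow> u \<noteq> v \<Longrightarrow> edist k (m u) (m v) = 2 \<longleftrightarrow> adj u v"
  using assms by (simp_all add: contact_centers_def)

lemma strip_contact_centers:
  assumes fam: "gball_family (Suc k) W A b c"
    and u: "u0 \<in> W" "u1 \<in> W" "u0 \<noteq> u1" and inf: "A u0 \<le> 0" "A u1 \<le> 0"
    and tan: "\<And>u v. u \<in> W \<Longrightarrow> v \<in> W \<Longrightarrow> u \<noteq> v \<Longrightarrow>
      tangent (gball (Suc k) (A u) (b u) (c u)) (gball (Suc k) (A v) (b v) (c v)) \<longleftrightarrow> adj u v"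
    and adj: "\<And>v w. v \<in> W - {u0, u1} \<Longrightarrow> w \<in> {u0, u1} \<Longrightarrow> adj v w"
    and ne: "W - {u0, u1} \<noteq> {}"
  shows "\<exists>m. contact_centers k (W - {u0, u1}) adj m"
proof -
  let ?d = "Suc k" and ?W = "W - {u0, u1}"
  let ?B = "\<lambda>v. gball ?d (A v) (b v) (c v)" and ?O = "\<lambda>v. gopen ?d (A v) (b v) (c v)"
  have meet: "?B v \<inter> ?B w \<noteq> {}" if "v \<in> ?W" "w \<in> {u0, u1}" for v w
  proof -
    have vw: "v \<in> W" "w \<in> W" "v \<noteq> w"
      using that u by auto
    have "tangent (?B v) (?B w)"
      using tan[OF vw] adj[OF that] by simp
    then show ?thesis by (auto simp: tangent_def)
  qed
  obtain n r h m where n: "n \<in> euc ?d" "einner ?d n n = 1" and r: "0 < r"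
    and m: "\<And>v. v \<in> ?W \<Longrightarrow> m v \<in> euc ?d \<and> einner ?d n (m v) = h
       \<and> ?B v = Some ` {x \<in> euc ?d. edist ?d x (m v) \<le> r}
       \<and> ?O v = Some ` {x \<in> euc ?d. edist ?d x (m v) < r}"
    by (rule gball_family_strip[OF fam u inf meet ne]) blast+
  obtain H where H: "\<And>x y. einner ?d n x = einner ?d n y \<Longrightarrow> edist k (H x) (H y) = edist ?d x y"
    by (rule hyperplane_isometry[OF n(2)]) blast
  \<comment> \<open>Cutting off the coordinates from \<open>k\<close> on puts the point into
    \<open>euc k\<close> without affecting \<open>edist k\<close>; dividing by \<open>r\<close>
    makes the radius 1.\<close>
  define m' where "m' = (\<lambda>v i. if i < k then H (m v) i / r else 0)"
  have dist: "edist k (m' u) (m' v) = edist ?d (m u) (m v) / r" if "u \<in> ?W" "v \<in> ?W" for u v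
    unfolding m'_def edist_scaled_restrict[OF r] using m[OF that(1)] m[OF that(2)] H by simp
  have "contact_centers k ?W adj m'"
    unfolding contact_centers_def
  proof (intro conjI ballI impI)
    show "m' v \<in> euc k" for v
      by (simp add: m'_def euc_def)
    fix u v assume uv: "u \<in> ?W" "v \<in> ?W" "u \<noteq> v"
    have sep: "edist ?d (m u) (m v) \<ge> 2 * r"
    proof (rule ccontr)
      assume "\<not> edist ?d (m u) (m v) \<ge> 2 * r"
      then have "Some (midpt (m u) (m v)) \<in> ?O u \<inter> ?O v"
        using m[OF uv(1)] m[OF uv(2)] midpt_in_open_balls[of ?d "m u" "m v" r]
        by (auto simp: midpt_in_euc)
      moreover have "?O u \<inter> ?O v = {}"
        using fam uv unfolding gball_family_def by blast
      ultimately show False by blast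
    qed
    then show "edist k (m' u) (m' v) \<ge> 2"
      using r by (simp add: dist[OF uv(1,2)] pos_le_divide_eq)
    have "m u \<noteq> m v"
      using sep r by (auto simp: edist_def)
    then have "tangent {x \<in> euc ?d. edist ?d x (m u) \<le> r} {x \<in> euc ?d. edist ?d x (m v) \<le> r}
        \<longleftrightarrow> edist ?d (m u) (m v) = 2 * r"
      using m[OF uv(1)] m[OF uv(2)] r by (intro tangent_balls_iff) auto
    moreover have "tangent (?B u) (?B v)
        \<longleftrightarrow> tangent {x \<in> euc ?d. edist ?d x (m u) \<le> r} {x \<in> euc ?d. edist ?d x (m v) \<le> r}"
      using m[OF uv(1)] m[OF uv(2)] tangent_image[of Some "UNIV :: (nat \<Rightarrow> real) set"] by simp
    moreover have "tangent (?B u) (?B v) \<longleftrightarrow> adj u v"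
      using uv by (intro tan) auto
    ultimately show "edist k (m' u) (m' v) = 2 \<longleftrightarrow> adj u v"
      using r by (simp add: dist[OF uv(1,2)] divide_eq_eq)
  qed
  then show ?thesis by blast
qed


section \<open>Packings and centre configurations\<close>

text \<open>All that is used of the join is a pair of adjacent vertices that are adjacent to every
  other vertex; these two become the walls.\<close>

lemma ball_packable_imp_contact_centers:
  fixes \<Gamma> :: "'w graph"
  assumes pack: "ball_packable (Suc k) \<Gamma>"
    and u: "u0 \<in> fst \<Gamma>" "u1 \<in> fst \<Gamma>" "u0 \<noteq> u1" "snd \<Gamma> u0 u1"
    and adj: "\<And>v w. v \<in> fst \<Gamma> - {u0, u1} \<Longrightarrow> w \<in> {u0, u1} \<Longrightarrow> snd \<Gamma> v w"
    and ne: "fst \<Gamma> - {u0, u1} \<noteq> {}"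
  shows "\<exists>m. contact_centers k (fst \<Gamma> - {u0, u1}) (snd \<Gamma>) m"
proof -
  let ?d = "Suc k" and ?W = "fst \<Gamma>"
  obtain P f where P: "d_ball_packing ?d P" and bij: "bij_betw f ?W P"
    and iso: "\<And>u v. u \<in> ?W \<Longrightarrow> v \<in> ?W \<Longrightarrow> snd \<Gamma> u v \<longleftrightarrow> snd (tangency_graph P) (f u) (f v)"
    using pack unfolding ball_packable_def graph_iso_def by (auto simp: tangency_graph_def)
  have fP: "f v \<in> P" if "v \<in> ?W" for v
    using bij that by (auto simp: bij_betw_def)
  have f_neq: "f u \<noteq> f v" if "u \<in> ?W" "v \<in> ?W" "u \<noteq> v" for u v
    using bij that by (auto simp: bij_betw_def inj_on_def)
  \<comment> \<open>The three coefficients are packed into one triple so that a single choice yields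
    them for all vertices.\<close>
  have "\<forall>v\<in>?W. \<exists>t. fst (snd t) \<in> euc ?d
      \<and> einner ?d (fst (snd t)) (fst (snd t)) - fst t * snd (snd t) > 0
      \<and> f v = gball ?d (fst t) (fst (snd t)) (snd (snd t))"
  proof
    fix v assume "v \<in> ?W"
    then have "d_ball ?d (f v)"
      using P fP unfolding d_ball_packing_def by blast
    then obtain A b c where "b \<in> euc ?d" "einner ?d b b - A * c > 0" "f v = gball ?d A b c"
      using d_ball_gball by blast
    then show "\<exists>t. fst (snd t) \<in> euc ?d
      \<and> einner ?d (fst (snd t)) (fst (snd t)) - fst t * snd (snd t) > 0
      \<and> f v = gball ?d (fst t) (fst (snd t)) (snd (snd t))"
      by (intro exI[of _ "(A, b, c)"]) simp
  qed
  then obtain t where t: "\<forall>v\<in>?W. fst (snd (t v)) \<in> euc ?d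
      \<and> einner ?d (fst (snd (t v))) (fst (snd (t v))) - fst (t v) * snd (snd (t v)) > 0
      \<and> f v = gball ?d (fst (t v)) (fst (snd (t v))) (snd (snd (t v)))"
    using bchoice[of ?W] by meson
  define A b c where "A = (\<lambda>v. fst (t v))" and "b = (\<lambda>v. fst (snd (t v)))"
    and "c = (\<lambda>v. snd (snd (t v)))"
  have coef: "b v \<in> euc ?d" "einner ?d (b v) (b v) - A v * c v > 0"
    and f_eq: "f v = gball ?d (A v) (b v) (c v)" if "v \<in> ?W" for v
    using t that by (auto simp: A_def b_def c_def)
  have fam: "gball_family ?d ?W A b c"
    unfolding gball_family_def
  proof (intro conjI ballI impI)
    fix u v assume uv: "u \<in> ?W" "v \<in> ?W" "u \<noteq> v"
    have "ext_interior ?d (f u) \<inter> ext_interior ?d (f v) = {}"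
      using P fP[OF uv(1)] fP[OF uv(2)] f_neq[OF uv] unfolding d_ball_packing_def by blast
    then show "gopen ?d (A u) (b u) (c u) \<inter> gopen ?d (A v) (b v) (c v) = {}"
      using gopen_subset_interior[of ?d "A u" "b u" "c u"]
        gopen_subset_interior[of ?d "A v" "b v" "c v"]
      unfolding f_eq[OF uv(1)] f_eq[OF uv(2)] by blast
  qed (use coef in auto)
  have tan: "tangent (gball ?d (A u) (b u) (c u)) (gball ?d (A v) (b v) (c v)) \<longleftrightarrow> snd \<Gamma> u v"
    if uv: "u \<in> ?W" "v \<in> ?W" "u \<noteq> v" for u v
    using iso[OF uv(1,2)] fP[OF uv(1)] fP[OF uv(2)] f_neq[OF uv] f_eq[OF uv(1)] f_eq[OF uv(2)]
    by (simp add: tangency_graph_def)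
  have "tangent (gball ?d (A u0) (b u0) (c u0)) (gball ?d (A u1) (b u1) (c u1))"
    using tan[OF u(1-3)] u(4) by simp
  then obtain p where "p \<in> gball ?d (A u0) (b u0) (c u0)" "p \<in> gball ?d (A u1) (b u1) (c u1)"
    unfolding tangent_def by blast
  then obtain A' b' c' where fam': "gball_family ?d ?W A' b' c'" and inf: "A' u0 \<le> 0" "A' u1 \<le> 0"
    and tan': "\<And>u v. tangent (gball ?d (A' u) (b' u) (c' u)) (gball ?d (A' v) (b' v) (c' v))
      \<longleftrightarrow> tangent (gball ?d (A u) (b u) (c u)) (gball ?d (A v) (b v) (c v))"
    by (rule gball_family_common_point_to_infinity[OF fam]) blast
  show ?thesis
    using tan unfolding tan'[symmetric]
    by (intro strip_contact_centers[OF fam' u(1-3) inf _ adj ne]) auto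
qed

section \<open>Building a packing from centres\<close>

lemma edist_shift:
  assumes "0 < d" "0 \<le> t"
  shows "edist d (\<lambda>i. x i + t * unit_vec 0 i) x = t"
proof -
  have "(edist d (\<lambda>i. x i + t * unit_vec 0 i) x)\<^sup>2 = t\<^sup>2"
    using assms unfolding edist_sq
    by (simp add: einner_linear einner_unit_vec power2_eq_square)
  then show ?thesis
    using assms by (simp add: power2_eq_iff_nonneg)
qed

text \<open>In positive dimension no nonempty open set is a single point: a neighbourhood of
  infinity contains far points, and a neighbourhood of a finite point contains its small
  shifts.\<close>

lemma ext_interior_disjoint:
  assumes d: "0 < d" and p: "B \<inter> C \<subseteq> {p}"
  shows "ext_interior d B \<inter> ext_interior d C = {}"
proof (rule ccontr)
  assume "ext_interior d B \<inter> ext_interior d C \<noteq> {}"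
  then obtain x U V where U: "ext_open d U" "U \<subseteq> B" "x \<in> U" and V: "ext_open d V" "V \<subseteq> C" "x \<in> V"
    unfolding ext_interior_def by blast
  then have xp: "x = p" using p by blast
  show False
  proof (cases x)
    case None
    obtain R R' where R: "\<forall>y\<in>euc d. edist d y (\<lambda>_. 0) > R \<longrightarrow> Some y \<in> U"
      "\<forall>y\<in>euc d. edist d y (\<lambda>_. 0) > R' \<longrightarrow> Some y \<in> V"
      using U V None unfolding ext_open_def by blast
    \<comment> \<open>The \<open>0 +\<close> gives the term the shape of \<open>edist_shift\<close>;
      the length exceeds both \<open>R\<close> and \<open>R'\<close>.\<close>
    let ?y = "\<lambda>i. 0 + (\<bar>R\<bar> + \<bar>R'\<bar> + 1) * unit_vec 0 i"
    have "edist d ?y (\<lambda>_. 0) = \<bar>R\<bar> + \<bar>R'\<bar> + 1"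
      by (rule edist_shift[OF d]) simp
    then have "edist d ?y (\<lambda>_. 0) > R" "edist d ?y (\<lambda>_. 0) > R'"
      by linarith+
    moreover have "?y \<in> euc d"
      using d by (intro euc_closed zero_in_euc unit_vec_in_euc)
    ultimately have "Some ?y \<in> U \<inter> V"
      using R by blast
    then show False
      using U V p xp None by blast
  next
    case (Some z)
    then have z: "z \<in> euc d"
      using U unfolding ext_open_def by auto
    obtain e e' where e: "e > 0" "\<forall>y\<in>euc d. edist d z y < e \<longrightarrow> Some y \<in> U"
      and e': "e' > 0" "\<forall>y\<in>euc d. edist d z y < e' \<longrightarrow> Some y \<in> V"
      using U V Some unfolding ext_open_def by blast
    define t where "t = min e e' / 2"
    have t: "0 < t" "t < e" "t < e'"
      using e e' by (auto simp: t_def)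
    let ?y = "\<lambda>i. z i + t * unit_vec 0 i"
    have "edist d z ?y = t"
      using edist_shift[OF d, of t z] t by (simp add: edist_commute)
    moreover have "?y \<in> euc d"
      using d z by (intro euc_closed unit_vec_in_euc)
    ultimately have "Some ?y \<in> U \<inter> V"
      using t e e' by simp
    moreover have "?y 0 \<noteq> z 0"
      using t by simp
    then have "?y \<noteq> z"
      by metis
    ultimately show False
      using U V p xp Some by blast
  qed
qed

text \<open>A packing is a set, so distinct vertices must get distinct balls. Equal ones would lie
  in a single point by \<open>one\<close>, against \<open>two\<close>.\<close>

lemma ball_packableI:
  assumes d: "0 < d"
    and ball: "\<And>v. v \<in> W \<Longrightarrow> d_ball d (f v)"
    and two: "\<And>v. v \<in> W \<Longrightarrow> \<exists>p\<in>f v. \<exists>q\<in>f v. p \<noteq> q"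
    and irrefl: "\<And>v. v \<in> W \<Longrightarrow> \<not> adj v v"
    and one: "\<And>u v. u \<in> W \<Longrightarrow> v \<in> W \<Longrightarrow> u \<noteq> v \<Longrightarrow> \<exists>p. f u \<inter> f v \<subseteq> {p}"
    and tan: "\<And>u v. u \<in> W \<Longrightarrow> v \<in> W \<Longrightarrow> u \<noteq> v \<Longrightarrow> tangent (f u) (f v) \<longleftrightarrow> adj u v"
  shows "ball_packable d (W, adj)"
proof -
  have neq: "f u \<noteq> f v" if uv: "u \<in> W" "v \<in> W" "u \<noteq> v" for u v
  proof
    assume "f u = f v"
    then obtain p where "f u \<subseteq> {p}"
      using one[OF uv] by auto
    then show False
      using two[OF uv(1)] by blast
  qed
  then have bij: "bij_betw f W (f ` W)"
    by (auto simp: bij_betw_def inj_on_def)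
  have "d_ball_packing d (f ` W)"
    unfolding d_ball_packing_def
  proof (intro conjI ballI impI)
    fix B C assume "B \<in> f ` W" "C \<in> f ` W" "B \<noteq> C"
    then obtain u v where uv: "B = f u" "C = f v" "u \<in> W" "v \<in> W" "u \<noteq> v"
      by auto
    then show "ext_interior d B \<inter> ext_interior d C = {}"
      using one[OF uv(3-5)] ext_interior_disjoint[OF d] by blast
  qed (use ball in auto)
  moreover have "graph_iso (W, adj) (tangency_graph (f ` W))"
    unfolding graph_iso_def
  proof (intro exI[of _ f] conjI ballI)
    fix u v assume "u \<in> fst (W, adj)" "v \<in> fst (W, adj)"
    then show "snd (W, adj) u v \<longleftrightarrow> snd (tangency_graph (f ` W)) (f u) (f v)"
      using irrefl[of u] tan[of u v] neq[of u v] by (cases "u = v") (auto simp: tangency_graph_def)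
  qed (use bij in \<open>simp add: tangency_graph_def\<close>)
  ultimately show ?thesis
    unfolding ball_packable_def by blast
qed

lemma euc_mono: "x \<in> euc k \<Longrightarrow> x \<in> euc (Suc k)"
  by (simp add: euc_def)

text \<open>By Pythagoras the last coordinate already uses up the whole radius, which leaves nothing
  for the first \<open>k\<close> coordinates. The sign \<open>\<sigma>\<close> covers the upper and
  the lower wall at once.\<close>

lemma ball_touches_wall:
  assumes x: "x \<in> euc (Suc k)" and c: "c \<in> euc k" and \<sigma>: "\<sigma> = 1 \<or> \<sigma> = -1"
  shows "edist (Suc k) x c \<le> 1 \<and> \<sigma> * x k \<ge> 1 \<longleftrightarrow> x = (\<lambda>i. c i + \<sigma> * unit_vec k i)"
proof -
  let ?y = "\<lambda>i. c i + \<sigma> * unit_vec k i"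
  have ck: "c k = 0"
    using c by (simp add: euc_def)
  have cong: "edist k x ?y = edist k x c" "edist k ?y c = 0"
    by (auto simp: edist_def unit_vec_def intro!: sum.cong)
  show ?thesis
  proof
    assume asm: "edist (Suc k) x c \<le> 1 \<and> \<sigma> * x k \<ge> 1"
    then have "(edist (Suc k) x c)\<^sup>2 \<le> 1"
      by (simp add: power_le_one)
    then have le: "(edist k x c)\<^sup>2 + (x k)\<^sup>2 \<le> 1"
      by (simp add: edist_Suc ck)
    then have "(x k)\<^sup>2 \<le> 1"
      using zero_le_power2[of "edist k x c"] by linarith
    then have "\<bar>x k\<bar> \<le> 1"
      by (simp add: abs_square_le_1)
    then have xk: "x k = \<sigma>"
      using asm \<sigma> by auto
    then have "(edist k x c)\<^sup>2 \<le> 0"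
      using le \<sigma> by auto
    then have "(edist (Suc k) x ?y)\<^sup>2 \<le> 0"
      using xk ck cong by (simp add: edist_Suc)
    moreover have "?y \<in> euc (Suc k)"
      using c by (intro euc_closed euc_mono unit_vec_in_euc) auto
    ultimately show "x = ?y"
      using x by (intro euc_eqI)
  next
    assume xy: "x = ?y"
    have "(edist (Suc k) ?y c)\<^sup>2 = 1"
      unfolding edist_Suc cong using \<sigma> by auto
    then show "edist (Suc k) x c \<le> 1 \<and> \<sigma> * x k \<ge> 1"
      unfolding xy using \<sigma> ck by (auto simp: power2_eq_1_iff)
  qed
qed

text \<open>For \<open>\<sigma>\<close> equal to 1 and -1 these bound a strip of width 2, the
  diameter of a unit ball centred on the hyperplane \<open>x k = 0\<close>.\<close>

definition wall :: "nat \<Rightarrow> real \<Rightarrow> (nat \<Rightarrow> real) option set" where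
  "wall k \<sigma> = insert None (Some ` {x \<in> euc (Suc k). \<sigma> * x k \<ge> 1})"

lemma d_ball_wall:
  assumes "\<sigma> \<noteq> 0"
  shows "d_ball (Suc k) (wall k \<sigma>)"
proof -
  let ?a = "\<lambda>i. (- \<sigma>) * unit_vec k i"
  have "einner (Suc k) ?a x = - (\<sigma> * x k)" for x
    unfolding einner_scale_left by (simp add: einner_unit_vec)
  then have "wall k \<sigma> = insert None (Some ` {x \<in> euc (Suc k). einner (Suc k) ?a x \<le> -1})"
    unfolding wall_def by simp
  moreover have "?a \<in> euc (Suc k)"
    by (intro euc_scale unit_vec_in_euc) simp
  moreover have "?a k \<noteq> 0"
    using assms by simp
  then have "?a \<noteq> (\<lambda>_. 0)"
    by metis
  ultimately show ?thesis
    unfolding d_ball_def by blast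
qed

lemma contact_centers_imp_ball_packable:
  assumes m: "contact_centers k (W - {u0, u1}) adj m"
    and u: "u0 \<in> W" "u1 \<in> W" "u0 \<noteq> u1"
    and sym: "\<And>v w. v \<in> W \<Longrightarrow> w \<in> W \<Longrightarrow> adj v w \<Longrightarrow> adj w v"
    and irrefl: "\<And>v. v \<in> W \<Longrightarrow> \<not> adj v v"
    and adj: "\<And>v w. v \<in> {u0, u1} \<Longrightarrow> w \<in> W \<Longrightarrow> v \<noteq> w \<Longrightarrow> adj v w"
  shows "ball_packable (Suc k) (W, adj)"
proof -
  let ?d = "Suc k"
  define f where "f = (\<lambda>v. if v = u0 then wall k 1 else if v = u1 then wall k (-1)
    else Some ` {x \<in> euc ?d. edist ?d x (m v) \<le> 1})"
  have m_euc: "m v \<in> euc k" "m v \<in> euc ?d" if "v \<in> W - {u0, u1}" for v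
    using m that by (auto simp: contact_centers_def euc_mono)
  have f_ball: "f v = Some ` {x \<in> euc ?d. edist ?d x (m v) \<le> 1}" if "v \<in> W - {u0, u1}" for v
    using that by (simp add: f_def)
  have f_wall: "\<exists>\<sigma>. (\<sigma> = 1 \<or> \<sigma> = -1) \<and> f v = wall k \<sigma>" if "v \<in> {u0, u1}" for v
    using that by (auto simp: f_def)
  have touch: "Some (\<lambda>i. m v i + \<sigma> * unit_vec k i) \<in> Some ` {x \<in> euc ?d. edist ?d x (m v) \<le> 1}"
    if v: "v \<in> W - {u0, u1}" and \<sigma>: "\<sigma> = 1 \<or> \<sigma> = -1" for v \<sigma>
  proof -
    have "(\<lambda>i. m v i + \<sigma> * unit_vec k i) \<in> euc ?d"
      using m_euc[OF v] by (intro euc_closed unit_vec_in_euc) auto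
    then show ?thesis
      using ball_touches_wall[OF _ m_euc(1)[OF v] \<sigma>] by blast
  qed
  have wall_ball: "wall k \<sigma> \<inter> f v = {Some (\<lambda>i. m v i + \<sigma> * unit_vec k i)}"
    if v: "v \<in> W - {u0, u1}" and \<sigma>: "\<sigma> = 1 \<or> \<sigma> = -1" for v \<sigma>
  proof -
    let ?y = "\<lambda>i. m v i + \<sigma> * unit_vec k i"
    have "?y \<in> euc ?d"
      using m_euc[OF v] by (intro euc_closed unit_vec_in_euc) auto
    then have "{x \<in> euc ?d. \<sigma> * x k \<ge> 1} \<inter> {x \<in> euc ?d. edist ?d x (m v) \<le> 1} = {?y}"
      using ball_touches_wall[OF _ m_euc(1)[OF v] \<sigma>] by auto
    then show ?thesis
      unfolding f_ball[OF v] wall_def by (auto simp flip: image_Int)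
  qed
  \<comment> \<open>The parallel walls touch at infinity and nowhere else.\<close>
  have walls: "f u0 \<inter> f u1 = {None}"
    using u by (auto simp: f_def wall_def)
  \<comment> \<open>Both requirements on a pair go together because the same split into walls and
    balls decides them.\<close>
  let ?C = "\<lambda>u v. (\<exists>p. f u \<inter> f v \<subseteq> {p}) \<and> (tangent (f u) (f v) \<longleftrightarrow> adj u v)"
  have C_sym: "?C v u" if "?C u v" "u \<in> W" "v \<in> W" for u v
    using that sym[of u v] sym[of v u] unfolding tangent_def by (auto simp: Int_commute)
  have C_one: "?C u v" if "f u \<inter> f v = {p}" "adj u v" for u v p
    using that by (auto simp: tangent_card)
  have C_wall: "?C u v" if u': "u \<in> {u0, u1}" and v: "v \<in> W" and uv: "u \<noteq> v" for u v
  proof (cases "v \<in> {u0, u1}")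
    case True
    then have "f u \<inter> f v = {None}"
      using u' uv walls by auto
    then show ?thesis
      using adj[OF u' v uv] by (rule C_one)
  next
    case False
    obtain \<sigma> where \<sigma>: "\<sigma> = 1 \<or> \<sigma> = -1" "f u = wall k \<sigma>"
      using f_wall[OF u'] by blast
    show ?thesis
      using wall_ball[of v \<sigma>] False v \<sigma> adj[OF u' v uv] by (intro C_one) auto
  qed
  have C_ball: "?C u v" if uv: "u \<in> W - {u0, u1}" "v \<in> W - {u0, u1}" "u \<noteq> v" for u v
  proof -
    \<comment> \<open>Fattening keeps the centres, whose coordinate \<open>k\<close> is 0, so
      distances do not change.\<close>
    have "(edist ?d (m u) (m v))\<^sup>2 = (edist k (m u) (m v))\<^sup>2"
      using m_euc(1)[OF uv(1)] m_euc(1)[OF uv(2)] by (simp add: edist_Suc euc_def)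
    then have dist: "edist ?d (m u) (m v) = edist k (m u) (m v)"
      by (simp add: power2_eq_iff_nonneg)
    have sep: "edist ?d (m u) (m v) \<ge> 2 * 1" and tan: "edist ?d (m u) (m v) = 2 * 1 \<longleftrightarrow> adj u v"
      unfolding dist using m uv by (auto simp: contact_centers_def)
    have "m u \<noteq> m v"
      using sep by (auto simp: edist_def)
    then have "tangent {x \<in> euc ?d. edist ?d x (m u) \<le> 1} {x \<in> euc ?d. edist ?d x (m v) \<le> 1}
        \<longleftrightarrow> edist ?d (m u) (m v) = 2 * 1"
      by (intro tangent_balls_iff m_euc uv) auto
    then have "tangent (f u) (f v) \<longleftrightarrow> adj u v"
      unfolding f_ball[OF uv(1)] f_ball[OF uv(2)] using tan tangent_image[of Some "UNIV :: (nat \<Rightarrow> real) set"] by simp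
    moreover have "f u \<inter> f v \<subseteq> {Some (midpt (m u) (m v))}"
      unfolding f_ball[OF uv(1)] f_ball[OF uv(2)]
      using far_balls_inter[OF m_euc(2)[OF uv(1)] m_euc(2)[OF uv(2)] _ _ sep] by auto
    ultimately show ?thesis by blast
  qed
  have C: "?C u v" if uv: "u \<in> W" "v \<in> W" "u \<noteq> v" for u v
  proof (cases "u \<in> {u0, u1}")
    case True
    then show ?thesis by (rule C_wall[OF _ uv(2,3)])
  next
    case u': False
    show ?thesis
    proof (cases "v \<in> {u0, u1}")
      case True
      then show ?thesis
        by (rule C_sym[OF C_wall[OF _ uv(1) uv(3)[symmetric]] uv(2,1)])
    next
      case False
      show ?thesis
        by (rule C_ball) (use uv u' False in auto)
    qed
  qed
  show ?thesis
  proof (rule ball_packableI[where f = f])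
    fix v assume v: "v \<in> W"
    show "d_ball ?d (f v)"
    proof (cases "v \<in> {u0, u1}")
      case True
      then show ?thesis using f_wall d_ball_wall by fastforce
    next
      case False
      then have "v \<in> W - {u0, u1}" using v by simp
      then show ?thesis
        unfolding f_ball[OF \<open>v \<in> W - {u0, u1}\<close>] d_ball_def
        using m_euc(2) zero_less_one by blast
    qed
    show "\<exists>p\<in>f v. \<exists>q\<in>f v. p \<noteq> q"
    proof (cases "v \<in> {u0, u1}")
      case True
      then obtain \<sigma> where \<sigma>: "\<sigma> = 1 \<or> \<sigma> = -1" "f v = wall k \<sigma>"
        using f_wall by blast
      have "(\<lambda>i. \<sigma> * unit_vec k i) \<in> euc ?d"
        by (intro euc_scale unit_vec_in_euc) simp
      then have "Some (\<lambda>i. \<sigma> * unit_vec k i) \<in> wall k \<sigma>" "None \<in> wall k \<sigma>"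
        using \<sigma>(1) by (auto simp: wall_def)
      then show ?thesis
        unfolding \<sigma>(2) by blast
    next
      case False
      then have v': "v \<in> W - {u0, u1}" using v by simp
      \<comment> \<open>The two points of the ball are its contacts with the two walls.\<close>
      have "m v k + 1 * unit_vec k k \<noteq> m v k + (-1) * unit_vec k k"
        by simp
      then have "(\<lambda>i. m v i + 1 * unit_vec k i) \<noteq> (\<lambda>i. m v i + (-1) * unit_vec k i)"
        by metis
      then show ?thesis
        using touch[OF v', of 1] touch[OF v', of "-1"] unfolding f_ball[OF v'] by blast
    qed
    show "\<not> adj v v"
      by (rule irrefl[OF v])
    fix w assume w: "w \<in> W" "v \<noteq> w"
    show "\<exists>p. f v \<inter> f w \<subseteq> {p}" "tangent (f v) (f w) \<longleftrightarrow> adj v w"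
      using C[OF v w] by simp_all
  qed simp
qed


section \<open>Kissing configurations and centre configurations\<close>

text \<open>A small shift of a common interior point is a second common point. This takes a
  direction to shift in: in dimension 0 a single point is its own interior.\<close>

lemma euc_interior_disjoint:
  assumes n: "0 < n" and p: "B \<inter> C \<subseteq> {p}"
  shows "euc_interior n B \<inter> euc_interior n C = {}"
proof (rule ccontr)
  assume "euc_interior n B \<inter> euc_interior n C \<noteq> {}"
  then obtain x e e' where x: "x \<in> euc n" "x \<in> B" "x \<in> C"
    and e: "e > 0" "\<forall>y\<in>euc n. edist n x y < e \<longrightarrow> y \<in> B"
    and e': "e' > 0" "\<forall>y\<in>euc n. edist n x y < e' \<longrightarrow> y \<in> C"
    unfolding euc_interior_def by blast
  define t where "t = min e e' / 2"
  have t: "0 < t" "t < e" "t < e'"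
    using e e' by (auto simp: t_def)
  let ?y = "\<lambda>i. x i + t * unit_vec 0 i"
  have "edist n x ?y = t"
    using edist_shift[OF n, of t x] t by (simp add: edist_commute)
  moreover have "?y \<in> euc n"
    using n x by (intro euc_closed unit_vec_in_euc)
  ultimately have "?y \<in> B \<inter> C"
    using t e e' by simp
  moreover have "?y 0 \<noteq> x 0"
    using t by simp
  then have "?y \<noteq> x"
    by metis
  ultimately show False
    using x p by blast
qed

lemma in_interior_unit_ball:
  assumes "x \<in> euc n" "edist n x c < 1"
  shows "x \<in> euc_interior n (unit_ball n c)"
proof -
  \<comment> \<open>As a sublevel set, the unit ball inherits the neighbourhood estimate for
    \<open>qval\<close>.\<close>
  have "qval n 1 c (einner n c c - 1\<^sup>2) x < 0"
    unfolding qval_ball using assms by (simp add: power_less_one_iff)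
  then obtain e where "e > 0" "\<forall>y. edist n x y < e \<longrightarrow> qval n 1 c (einner n c c - 1\<^sup>2) y < 0"
    using qval_neg_nbhd by blast
  then have "e > 0" "\<forall>y\<in>euc n. edist n x y < e \<longrightarrow> y \<in> unit_ball n c"
    unfolding qval_ball unit_ball_def by (auto simp: power_less_one_iff less_imp_le)
  then show ?thesis
    using assms unfolding euc_interior_def unit_ball_def by auto
qed

lemma tangent_unit_balls_iff:
  assumes "u \<in> euc n" "v \<in> euc n" "u \<noteq> v"
  shows "tangent (unit_ball n u) (unit_ball n v) \<longleftrightarrow> edist n u v = 2"
  using tangent_balls_iff[OF assms zero_less_one] by (simp add: unit_ball_def)

lemma join_complete_simps:
  "fst (graph_join (complete_graph k) G) = Inl ` {..<k} \<union> Inr ` fst G"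
  "snd (graph_join (complete_graph k) G) (Inl i) (Inl j) \<longleftrightarrow> i < k \<and> j < k \<and> i \<noteq> j"
  "snd (graph_join (complete_graph k) G) (Inl i) (Inr y) \<longleftrightarrow> i < k \<and> y \<in> fst G"
  "snd (graph_join (complete_graph k) G) (Inr x) (Inl j) \<longleftrightarrow> j < k \<and> x \<in> fst G"
  "snd (graph_join (complete_graph k) G) (Inr x) (Inr y) \<longleftrightarrow> snd G x y"
  by (auto simp: graph_join_def complete_graph_def)

text \<open>0 and 1 are the vertices that become walls; the \<alpha> remaining vertices of the
  complete graph stand for the fixed balls.\<close>

lemma join_minus_two:
  "fst (graph_join (complete_graph (2 + \<alpha>)) G) - {Inl 0, Inl 1}
    = Inl ` {2..<2 + \<alpha>} \<union> Inr ` fst G"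
  unfolding join_complete_simps by (auto simp: image_iff)

text \<open>The \<open>Inl\<close> vertices give the fixed balls and the \<open>Inr\<close> vertices
  the configuration. Every tangency demanded of a fixed ball is an edge of the join.\<close>

lemma contact_centers_imp_kissing:
  fixes G :: "'v graph" and \<alpha> :: nat
  defines "\<Gamma> \<equiv> graph_join (complete_graph (2 + \<alpha>)) G"
  assumes n: "0 < n" and G: "finite_graph G"
    and m: "contact_centers n (Inl ` {2..<2 + \<alpha>} \<union> Inr ` fst G) (snd \<Gamma>) m"
  shows "\<exists>S. kissing_config n \<alpha> S \<and> graph_iso G (tangency_graph S)"
proof -
  let ?W = "Inl ` {2..<2 + \<alpha>} \<union> Inr ` fst G"
  define U where "U = (\<lambda>v. unit_ball n (m v))"
  have m_euc: "m v \<in> euc n" if "v \<in> ?W" for v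
    by (rule contact_centersD(1)[OF m that])
  have sep: "edist n (m u) (m v) \<ge> 2" and tan: "edist n (m u) (m v) = 2 \<longleftrightarrow> snd \<Gamma> u v"
    if "u \<in> ?W" "v \<in> ?W" "u \<noteq> v" for u v
    by (rule contact_centersD(2,3)[OF m that])+
  have m_neq: "m u \<noteq> m v" if "u \<in> ?W" "v \<in> ?W" "u \<noteq> v" for u v
    using sep[OF that] by (auto simp: edist_def)
  have U_tan: "tangent (U u) (U v) \<longleftrightarrow> snd \<Gamma> u v" if "u \<in> ?W" "v \<in> ?W" "u \<noteq> v" for u v
    unfolding U_def tangent_unit_balls_iff[OF m_euc[OF that(1)] m_euc[OF that(2)] m_neq[OF that]]
    by (rule tan[OF that])
  have U_neq: "U u \<noteq> U v" if "u \<in> ?W" "v \<in> ?W" "u \<noteq> v" for u v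
  proof
    assume "U u = U v"
    moreover have "m u \<in> U u"
      using m_euc[OF that(1)] by (simp add: U_def unit_ball_def edist_def)
    ultimately have "edist n (m u) (m v) \<le> 1"
      by (simp add: U_def unit_ball_def)
    then show False
      using sep[OF that] by simp
  qed
  have U_disj: "euc_interior n (U u) \<inter> euc_interior n (U v) = {}"
    if "u \<in> ?W" "v \<in> ?W" "u \<noteq> v" for u v
  proof (rule euc_interior_disjoint[OF n])
    show "U u \<inter> U v \<subseteq> {midpt (m u) (m v)}"
      using far_balls_inter[OF m_euc[OF that(1)] m_euc[OF that(2)], of _ 1] sep[OF that]
      by (auto simp: U_def unit_ball_def)
  qed
  have U_unit: "is_unit_ball n (U v)" if "v \<in> ?W" for v
    using m_euc[OF that] by (auto simp: is_unit_ball_def U_def)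
  define F S where "F = U ` Inl ` {2..<2 + \<alpha>}" and "S = U ` Inr ` fst G"
  have inj: "inj_on U ?W"
    by (rule inj_onI) (metis U_neq)
  have "card F = card (Inl ` {2..<2 + \<alpha>} :: (nat + 'v) set)"
    unfolding F_def by (rule card_image[OF inj_on_subset[OF inj]]) blast
  also have "\<dots> = \<alpha>"
    by (simp add: card_image)
  finally have cardF: "card F = \<alpha>" .
  have "kissing_config n \<alpha> S"
    unfolding kissing_config_def
  proof (intro exI[of _ F] conjI ballI impI)
    show "finite F" "card F = \<alpha>"
      using cardF by (simp_all add: F_def)
    show "is_unit_ball n C" if "C \<in> F" for C
      using that U_unit unfolding F_def by blast
    show "tangent C C'" if C: "C \<in> F" "C' \<in> F" "C \<noteq> C'" for C C'
    proof -
      obtain i j where ij: "C = U (Inl i)" "C' = U (Inl j)" "i \<in> {2..<2 + \<alpha>}" "j \<in> {2..<2 + \<alpha>}"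
        using C unfolding F_def by blast
      then have "i \<noteq> j" using C by auto
      then show ?thesis
        using ij U_tan[of "Inl i" "Inl j"] by (simp add: \<Gamma>_def join_complete_simps)
    qed
    show "S \<inter> F = {}"
      using U_neq[of "Inr _" "Inl _"] unfolding S_def F_def by auto
    show "is_unit_ball n B" if "B \<in> S" for B
      using that U_unit unfolding S_def by blast
    show "euc_interior n B \<inter> euc_interior n B' = {}" if B: "B \<in> S" "B' \<in> S" "B \<noteq> B'" for B B'
    proof -
      obtain x y where xy: "B = U (Inr x)" "B' = U (Inr y)" "x \<in> fst G" "y \<in> fst G"
        using B unfolding S_def by blast
      then have "x \<noteq> y" using B by auto
      then show ?thesis
        using xy U_disj[of "Inr x" "Inr y"] by simp
    qed
    show "tangent B C" if BC: "B \<in> S" "C \<in> F" for B C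
    proof -
      obtain x j where xj: "B = U (Inr x)" "C = U (Inl j)" "x \<in> fst G" "j \<in> {2..<2 + \<alpha>}"
        using BC unfolding S_def F_def by blast
      then show ?thesis
        using U_tan[of "Inr x" "Inl j"] by (simp add: \<Gamma>_def join_complete_simps)
    qed
  qed
  moreover have "graph_iso G (tangency_graph S)"
    unfolding graph_iso_def
  proof (intro exI[of _ "\<lambda>x. U (Inr x)"] conjI ballI)
    have "inj_on (\<lambda>x. U (Inr x)) (fst G)"
      by (rule inj_onI) (metis U_neq UnI2 imageI sum.inject(2))
    then show "bij_betw (\<lambda>x. U (Inr x)) (fst G) (fst (tangency_graph S))"
      by (auto simp: bij_betw_def tangency_graph_def S_def)
    fix x y assume xy: "x \<in> fst G" "y \<in> fst G"
    show "snd G x y \<longleftrightarrow> snd (tangency_graph S) (U (Inr x)) (U (Inr y))"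
    \<comment> \<open>Contact centres say nothing about a vertex and itself; on the diagonal neither
      graph has a loop.\<close>
    proof (cases "x = y")
      case True
      then show ?thesis
        using G by (simp add: tangency_graph_def finite_graph_def)
    next
      case False
      then show ?thesis
        using xy U_tan[of "Inr x" "Inr y"] U_neq[of "Inr x" "Inr y"]
        unfolding tangency_graph_def S_def \<Gamma>_def join_complete_simps by simp
    qed
  qed
  ultimately show ?thesis by blast
qed

text \<open>For a pair involving a fixed ball, tangency alone puts the centres at distance 2.
  Disjoint interiors are assumed, and used, only within \<open>S\<close>.\<close>

lemma kissing_imp_contact_centers:
  fixes G :: "'v graph" and \<alpha> :: nat
  defines "\<Gamma> \<equiv> graph_join (complete_graph (2 + \<alpha>)) G"
  assumes kiss: "kissing_config n \<alpha> S" and iso: "graph_iso G (tangency_graph S)"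
  shows "\<exists>m. contact_centers n (Inl ` {2..<2 + \<alpha>} \<union> Inr ` fst G) (snd \<Gamma>) m"
proof -
  let ?W = "Inl ` {2..<2 + \<alpha>} \<union> Inr ` fst G"
  obtain F where F: "finite F" "card F = \<alpha>" "\<forall>C\<in>F. is_unit_ball n C"
    "\<forall>C\<in>F. \<forall>C'\<in>F. C \<noteq> C' \<longrightarrow> tangent C C'"
    and FS: "S \<inter> F = {}" "\<forall>B\<in>S. \<forall>C\<in>F. tangent B C"
    and S: "\<forall>B\<in>S. is_unit_ball n B"
    "\<forall>B\<in>S. \<forall>B'\<in>S. B \<noteq> B' \<longrightarrow> euc_interior n B \<inter> euc_interior n B' = {}"
    using kiss unfolding kissing_config_def by (elim exE conjE) (rule that)
  obtain g where g: "bij_betw g (fst G) S"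
    and g_adj: "\<forall>x\<in>fst G. \<forall>y\<in>fst G. snd G x y \<longleftrightarrow> snd (tangency_graph S) (g x) (g y)"
    using iso unfolding graph_iso_def by (auto simp: tangency_graph_def)
  have "card {2..<2 + \<alpha>} = card F"
    using F by simp
  \<comment> \<open>The \<alpha> vertices left in the complete graph number the fixed balls in an
    arbitrary order.\<close>
  then obtain h where h: "bij_betw h {2..<2 + \<alpha>} F"
    using finite_same_card_bij[OF finite_atLeastLessThan F(1)] by blast
  define U where "U = case_sum h g"
  have U_simps [simp]: "U (Inl i) = h i" "U (Inr x) = g x" for i x
    by (simp_all add: U_def)
  have hF: "h i \<in> F" if "i \<in> {2..<2 + \<alpha>}" for i
    using h that by (auto simp: bij_betw_def)
  have gS: "g x \<in> S" if "x \<in> fst G" for x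
    using g that by (auto simp: bij_betw_def)
  have "is_unit_ball n (U v)" if "v \<in> ?W" for v
    using that hF gS F(3) S(1) by auto
  then have "\<exists>c. c \<in> euc n \<and> U v = unit_ball n c" if "v \<in> ?W" for v
    using that unfolding is_unit_ball_def by blast
  then obtain m where m: "\<And>v. v \<in> ?W \<Longrightarrow> m v \<in> euc n \<and> U v = unit_ball n (m v)"
    by metis
  \<comment> \<open>The tangency criterion needs distinct centres, hence distinct balls. Between a
    fixed ball and one of the configuration this is \<open>S \<inter> F = {}\<close>.\<close>
  have U_neq: "U u \<noteq> U v" if uv: "u \<in> ?W" "v \<in> ?W" "u \<noteq> v" for u v
  proof -
    consider (FF) i j where "u = Inl i" "v = Inl j" "i \<in> {2..<2 + \<alpha>}" "j \<in> {2..<2 + \<alpha>}"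
      | (FS) i y where "u = Inl i" "v = Inr y" "i \<in> {2..<2 + \<alpha>}" "y \<in> fst G"
      | (SF) x j where "u = Inr x" "v = Inl j" "x \<in> fst G" "j \<in> {2..<2 + \<alpha>}"
      | (SS) x y where "u = Inr x" "v = Inr y" "x \<in> fst G" "y \<in> fst G"
      using uv by blast
    then show ?thesis
    proof cases
      case FF
      then show ?thesis
        using h uv(3) by (auto simp: bij_betw_def inj_on_def)
    next
      case FS
      then show ?thesis
        using hF gS \<open>S \<inter> F = {}\<close> by (metis IntI U_simps empty_iff)
    next
      case SF
      then show ?thesis
        using hF gS \<open>S \<inter> F = {}\<close> by (metis IntI U_simps empty_iff)
    next
      case SS
      then show ?thesis
        using g uv(3) by (auto simp: bij_betw_def inj_on_def)
    qed
  qed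
  have U_tan: "tangent (U u) (U v) \<longleftrightarrow> edist n (m u) (m v) = 2"
    if uv: "u \<in> ?W" "v \<in> ?W" "u \<noteq> v" for u v
  proof -
    have "m u \<noteq> m v"
      using U_neq[OF uv] m[OF uv(1)] m[OF uv(2)] by auto
    then show ?thesis
      using tangent_unit_balls_iff[of "m u" n "m v"] m[OF uv(1)] m[OF uv(2)] by simp
  qed
  have tan_sym: "tangent C B" if "tangent B C" for B C :: "(nat \<Rightarrow> real) set"
    using that by (simp add: tangent_def Int_commute)
  have main: "edist n (m u) (m v) \<ge> 2 \<and> (edist n (m u) (m v) = 2 \<longleftrightarrow> snd \<Gamma> u v)"
    if uv: "u \<in> ?W" "v \<in> ?W" "u \<noteq> v" for u v
  proof -
    consider (FF) i j where "u = Inl i" "v = Inl j" "i \<in> {2..<2 + \<alpha>}" "j \<in> {2..<2 + \<alpha>}"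
      | (FS) i y where "u = Inl i" "v = Inr y" "i \<in> {2..<2 + \<alpha>}" "y \<in> fst G"
      | (SF) x j where "u = Inr x" "v = Inl j" "x \<in> fst G" "j \<in> {2..<2 + \<alpha>}"
      | (SS) x y where "u = Inr x" "v = Inr y" "x \<in> fst G" "y \<in> fst G"
      using uv by blast
    then show ?thesis
    proof cases
      case FF
      then have "tangent (U u) (U v)"
        using F(4) hF U_neq[OF uv] by simp
      then show ?thesis
        using U_tan[OF uv] FF uv(3) by (simp add: \<Gamma>_def join_complete_simps)
    next
      case FS
      then have "tangent (U u) (U v)"
        using \<open>\<forall>B\<in>S. \<forall>C\<in>F. tangent B C\<close> hF gS tan_sym by simp
      then show ?thesis
        using U_tan[OF uv] FS by (simp add: \<Gamma>_def join_complete_simps)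
    next
      case SF
      then have "tangent (U u) (U v)"
        using \<open>\<forall>B\<in>S. \<forall>C\<in>F. tangent B C\<close> hF gS by simp
      then show ?thesis
        using U_tan[OF uv] SF by (simp add: \<Gamma>_def join_complete_simps)
    next
      case SS
      have ge: "edist n (m u) (m v) \<ge> 2"
      proof (rule ccontr)
        assume "\<not> edist n (m u) (m v) \<ge> 2"
        then have "edist n (midpt (m u) (m v)) (m u) < 1" "edist n (midpt (m u) (m v)) (m v) < 1"
          using midpt_in_open_balls[of n "m u" "m v" 1] by simp_all
        moreover have "midpt (m u) (m v) \<in> euc n"
          using m[OF uv(1)] m[OF uv(2)] by (simp add: midpt_in_euc)
        ultimately have "midpt (m u) (m v) \<in> euc_interior n (U u) \<inter> euc_interior n (U v)"
          using m[OF uv(1)] m[OF uv(2)] in_interior_unit_ball by simp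
        moreover have "euc_interior n (U u) \<inter> euc_interior n (U v) = {}"
          using S(2) gS SS U_neq[OF uv] by simp
        ultimately show False by blast
      qed
      have "snd G x y \<longleftrightarrow> tangent (U u) (U v)" if "u = Inr x" "v = Inr y" for x y
        using g_adj gS SS U_neq[OF uv] that by (simp add: tangency_graph_def)
      then show ?thesis
        using ge U_tan[OF uv] SS by (simp add: \<Gamma>_def join_complete_simps)
    qed
  qed
  then have "contact_centers n ?W (snd \<Gamma>) m"
    unfolding contact_centers_def using m by blast
  then show ?thesis by blast
qed

theorem theorem3p4:
  fixes d \<alpha> :: nat and G :: "'v graph"
  assumes "d \<ge> 2" and "\<alpha> \<ge> 1" and "finite_graph G"
  shows "ball_packable d (graph_join (complete_graph (2 + \<alpha>)) G)
     \<longleftrightarrow> (\<exists>S. kissing_config (d - 1) \<alpha> S \<and> graph_iso G (tangency_graph S))"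
proof -
  define \<Gamma> where "\<Gamma> = graph_join (complete_graph (2 + \<alpha>)) G"
  define n where "n = d - 1"
  \<comment> \<open>\<open>d \<ge> 2\<close> makes the lower dimension positive, so that unit balls
    sharing one point have disjoint interiors there.\<close>
  have n: "0 < n" "d = Suc n"
    using assms(1) by (auto simp: n_def)
  have W: "fst \<Gamma> - {Inl 0, Inl 1} = Inl ` {2..<2 + \<alpha>} \<union> Inr ` fst G"
    unfolding \<Gamma>_def by (rule join_minus_two)
  \<comment> \<open>\<open>\<alpha> \<ge> 1\<close> supplies a vertex besides the walls, hence a
    ball that shows the strip between them to have positive width.\<close>
  have "Inl 2 \<in> fst \<Gamma> - {Inl 0, Inl 1}"
    unfolding W using assms(2) by simp
  then have ne: "fst \<Gamma> - {Inl 0, Inl 1} \<noteq> {}"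
    by blast
  have u: "Inl 0 \<in> fst \<Gamma>" "Inl 1 \<in> fst \<Gamma>" "(Inl 0 :: nat + 'v) \<noteq> Inl 1" "snd \<Gamma> (Inl 0) (Inl 1)"
    by (auto simp: \<Gamma>_def join_complete_simps)
  have sym: "snd \<Gamma> w v" if "v \<in> fst \<Gamma>" "w \<in> fst \<Gamma>" "snd \<Gamma> v w" for v w
    using that assms(3) by (auto simp: \<Gamma>_def join_complete_simps finite_graph_def)
  have irrefl: "\<not> snd \<Gamma> v v" if "v \<in> fst \<Gamma>" for v
    using that assms(3) by (auto simp: \<Gamma>_def join_complete_simps finite_graph_def)
  have adj: "snd \<Gamma> v w" if "v \<in> {Inl 0, Inl 1}" "w \<in> fst \<Gamma>" "v \<noteq> w" for v w
    using that by (auto simp: \<Gamma>_def join_complete_simps)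
  have adj': "snd \<Gamma> v w" if "v \<in> fst \<Gamma> - {Inl 0, Inl 1}" "w \<in> {Inl 0, Inl 1}" for v w
    using that by (auto simp: \<Gamma>_def join_complete_simps)
  have "ball_packable d \<Gamma> \<longleftrightarrow> (\<exists>m. contact_centers n (fst \<Gamma> - {Inl 0, Inl 1}) (snd \<Gamma>) m)"
  proof
    assume "ball_packable d \<Gamma>"
    then show "\<exists>m. contact_centers n (fst \<Gamma> - {Inl 0, Inl 1}) (snd \<Gamma>) m"
      unfolding n(2) by (rule ball_packable_imp_contact_centers[OF _ u adj' ne])
  next
    assume "\<exists>m. contact_centers n (fst \<Gamma> - {Inl 0, Inl 1}) (snd \<Gamma>) m"
    then obtain m where "contact_centers n (fst \<Gamma> - {Inl 0, Inl 1}) (snd \<Gamma>) m" ..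
    then have "ball_packable (Suc n) (fst \<Gamma>, snd \<Gamma>)"
      by (rule contact_centers_imp_ball_packable[OF _ u(1-3) sym irrefl adj])
    then show "ball_packable d \<Gamma>"
      by (simp add: n(2))
  qed
  also have "\<dots> \<longleftrightarrow> (\<exists>S. kissing_config n \<alpha> S \<and> graph_iso G (tangency_graph S))"
    unfolding W unfolding \<Gamma>_def
    using contact_centers_imp_kissing[OF n(1) assms(3)] kissing_imp_contact_centers by blast
  finally show ?thesis
    by (simp add: \<Gamma>_def n_def)
qed

end
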